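(* Let $l\ge 1$ be an integer and let $G$ be a simple connected graph with $|E(G)|-|V(G)|=l-1$. Then there exists a constant $\xi(G)>0$ such that a random $n$-lift of $G$ (for $n\ge 3$) has edge expansion at least $\xi(G)$ with probability $1-\frac{1}{n^{l-1}}+O\left(\frac{1}{n^{l}}\right)$ as $n\to\infty$.
   Context: A random $n$-lift $\tilde G$ of a graph $G$: orient the edges of $G$ arbitrarily and assign to each edge $e$ a permutation $\pi_e\in\mathcal{S}_n$, independently and uniformly at random; $\tilde G$ has vertex set $V(G)\times\{1,\dots,n\}$, with $(u,i)$ joined to $(v,j)$ iff there is an edge $e$ of $G$ oriented from $u$ to $v$ with $\pi_e(i)=j$. The edge expansion of a graph $H$ is $\min\{E(S,S^c)/|S| : S\subset V(H),\ 0<|S|\le |V(H)|/2\}$, where $E(S,S^c)$ is the number of edges with exactly one endpoint in $S$. *)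

theory Defs
  imports
    "HOL-Probability.Product_PMF"
    "HOL-Library.Landau_Symbols"
    "HOL-Combinatorics.Permutations"
    "Graph_Theory.Pair_Digraph"
    "Graph_Theory.Digraph_Component"
begin

text \<open>
  A finite simple graph is a \<^locale>\<open>pair_graph\<close>: a finite loop-free digraph without parallel arcs
  whose arc relation is symmetric. Every undirected edge is thus represented by two opposite
  arcs, so edges are counted through their sets of endpoints.
\<close>

definition edges :: "'a pair_pre_digraph \<Rightarrow> 'a set set" where
  "edges G = (\<lambda>(u, v). {u, v}) ` parcs G"

definition cut_edges :: "'a pair_pre_digraph \<Rightarrow> 'a set \<Rightarrow> 'a set set" where
  "cut_edges H S = {e \<in> edges H. card (e \<inter> S) = 1}"

text \<open>
  The minimum is only meaningful for finite graphs with at least two vertices; otherwise there is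
  no admissible \<open>S\<close> and the value is unspecified.
\<close>

definition edge_expansion :: "'a pair_pre_digraph \<Rightarrow> real" where
  "edge_expansion H =
     Min ((\<lambda>S. real (card (cut_edges H S)) / real (card S)) `
          {S. S \<subseteq> pverts H \<and> 0 < card S \<and> real (card S) \<le> real (card (pverts H)) / 2})"

text \<open>An orientation keeps exactly one of the two arcs of every edge.\<close>

definition orientation :: "'a pair_pre_digraph \<Rightarrow> ('a \<times> 'a) set \<Rightarrow> bool" where
  "orientation G A \<longleftrightarrow>
     A \<subseteq> parcs G \<and> (\<forall>(u, v) \<in> parcs G. (u, v) \<in> A \<longleftrightarrow> (v, u) \<notin> A)"

definition lift_graph ::
  "'a pair_pre_digraph \<Rightarrow> ('a \<times> 'a) set \<Rightarrow> nat \<Rightarrow> ('a \<times> 'a \<Rightarrow> nat \<Rightarrow> nat) \<Rightarrow>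
     ('a \<times> nat) pair_pre_digraph" where
  "lift_graph G A n \<pi> = mk_symmetric (with_proj
     \<lparr> pverts = pverts G \<times> {1..n},
       parcs = {((u, i), (v, j)) | u v i j.
                  (u, v) \<in> A \<and> i \<in> {1..n} \<and> j \<in> {1..n} \<and> \<pi> (u, v) i = j} \<rparr>)"

text \<open>
  \<^const>\<open>Pi_pmf\<close> is the product distribution, so the permutations attached to distinct arcs of
  \<open>A\<close> are independent; the value \<^const>\<open>id\<close> is used only outside \<open>A\<close>, where
  \<^const>\<open>lift_graph\<close> does not look.
\<close>

definition random_lift ::
  "'a pair_pre_digraph \<Rightarrow> ('a \<times> 'a) set \<Rightarrow> nat \<Rightarrow> ('a \<times> nat) pair_pre_digraph pmf" where
  "random_lift G A n =
     map_pmf (lift_graph G A n) (Pi_pmf A id (\<lambda>_. pmf_of_set {p. p permutes {1..n}}))"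

end

theory Submission
  imports Defs
begin

text \<open>
  Relabelling the fibres along a spanning tree turns the permutations on the tree edges into
  the identity and leaves the other \<open>l\<close> permutations independent and uniform. A set of small expansion
  in the lift is then close to a union of full copies of one set \<open>T \<subseteq> {1..n}\<close> of size at most \<open>n / 2\<close>
  that is almost invariant under the \<open>l\<close> permutations, and an exactly invariant \<open>T\<close> gives expansion 0.
  In the union bound, the \<open>n choose t\<close> sets of size \<open>t\<close> contribute at most
  \<open>b ^ l / (n choose t) ^ (l - 1)\<close>, where \<open>b\<close> is the number of admissible images of a set of size
  \<open>t\<close>. Singletons contribute \<open>1 / n ^ (l - 1)\<close>; for \<open>l \<ge> 2\<close> all other sets together contribute
  \<open>O(1 / n ^ l)\<close>, since \<open>b = 1\<close> for bounded \<open>t\<close> and \<open>b ^ 4 \<le> n choose t\<close> always. The lower bound on the failure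
  probability is the second Bonferroni inequality for common fixed points. For \<open>l = 1\<close> the
  single permutation must be an \<open>n\<close>-cycle, which has probability \<open>1 / n\<close>.
\<close>

section \<open>Images of a set under a random permutation\<close>

lemma ex_permutes_image:
  assumes "finite N" "S \<subseteq> N" "T \<subseteq> N" "card S = card T"
  shows "\<exists>q. q permutes N \<and> q ` S = T"
proof -
  have fin: "finite S" "finite T" using assms by (auto intro: finite_subset)
  obtain f where f: "bij_betw f S T"
    using finite_same_card_bij[OF fin assms(4)] by auto
  have "card (N - S) = card (N - T)" using assms fin by (simp add: card_Diff_subset)
  then obtain g where g: "bij_betw g (N - S) (N - T)"
    using finite_same_card_bij[of "N - S" "N - T"] assms(1) by auto
  define q where "q = (\<lambda>x. if x \<in> S then f x else if x \<in> N then g x else x)"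
  have qS: "bij_betw q S T" using f by (rule bij_betw_cong[THEN iffD1, rotated]) (simp add: q_def)
  have "bij_betw q (N - S) (N - T)"
    using g by (rule bij_betw_cong[THEN iffD1, rotated]) (simp add: q_def)
  with qS have "bij_betw q (S \<union> (N - S)) (T \<union> (N - T))"
    by (rule bij_betw_combine) auto
  moreover have "S \<union> (N - S) = N" "T \<union> (N - T) = N" using assms by auto
  ultimately have "q permutes N"
    using assms(2) by (intro bij_imp_permutes) (auto simp: q_def)
  with qS show ?thesis by (auto simp: bij_betw_def)
qed

text \<open>Left composition with a permutation carrying \<open>T\<close> to \<open>T'\<close> maps
  the permutations with image \<open>T\<close> bijectively to those with image \<open>T'\<close>.
  The \<open>fact (card N)\<close> permutations are thus shared equally among the
  \<open>card N choose card S\<close> possible images of \<open>S\<close>.\<close>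

lemma card_permutes_image:
  assumes "finite N" "S \<subseteq> N" "T \<subseteq> N" "card S = card T"
  shows "card {p. p permutes N \<and> p ` S = T} * (card N choose card S) = fact (card N)"
proof -
  define F where "F = (\<lambda>T. {p. p permutes N \<and> p ` S = T})"
  define I where "I = {T. T \<subseteq> N \<and> card T = card S}"
  have eq: "card (F T') = card (F T)" if T': "T' \<in> I" for T'
  proof -
    obtain q where q: "q permutes N" "q ` T = T'"
      using ex_permutes_image[of N T T'] assms T' by (auto simp: I_def)
    have "bij_betw (\<lambda>p. q \<circ> p) (F T) (F T')"
    proof (rule bij_betw_byWitness[where f' = "\<lambda>p. inv q \<circ> p"])
      show "\<forall>p\<in>F T. inv q \<circ> (q \<circ> p) = p" "\<forall>p\<in>F T'. q \<circ> (inv q \<circ> p) = p"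
        using permutes_inv_o[OF q(1)] by (auto simp: o_assoc)
      have "inv q ` T' = T" using q permutes_inj[OF q(1)] by (metis image_inv_f_f)
      then show "(\<lambda>p. inv q \<circ> p) ` F T' \<subseteq> F T"
        by (auto simp: F_def image_comp[symmetric] intro: permutes_compose permutes_inv[OF q(1)])
      show "(\<lambda>p. q \<circ> p) ` F T \<subseteq> F T'"
        using q by (auto simp: F_def image_comp[symmetric] intro: permutes_compose)
    qed
    then show ?thesis by (simp add: bij_betw_same_card)
  qed
  have finI: "finite I" using assms(1) by (auto simp: I_def)
  have finF: "finite (F T)" for T
    by (rule finite_subset[OF _ finite_permutations[OF assms(1)]]) (auto simp: F_def)
  have img: "p ` S \<subseteq> N" if "p permutes N" for p
    using permutes_image[OF that] assms(2) by blast
  have "{p. p permutes N} = (\<Union>T\<in>I. F T)"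
    using img by (auto simp: F_def I_def card_image permutes_inj_on)
  then have "fact (card N) = card (\<Union>T\<in>I. F T)"
    using card_permutations[OF refl assms(1)] by metis
  also have "\<dots> = (\<Sum>T\<in>I. card (F T))"
    using finI finF by (intro card_UN_disjoint) (auto simp: F_def)
  also have "\<dots> = (card N choose card S) * card (F T)"
    using eq n_subsets[OF assms(1), of "card S"] by (simp add: I_def)
  finally show ?thesis by (simp add: F_def mult.commute)
qed

lemma prob_permutes_image:
  assumes "finite N" "S \<subseteq> N" "T \<subseteq> N" "card S = card T"
  shows "measure_pmf.prob (pmf_of_set {p. p permutes N}) {p. p ` S = T} = 1 / (card N choose card S)"
proof -
  have "card S \<le> card N" using assms by (simp add: card_mono)
  then have pos: "(card N choose card S) > 0" by simp
  have "{p. p permutes N} \<noteq> {}" using permutes_id by blast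
  then have "measure_pmf.prob (pmf_of_set {p. p permutes N}) {p. p ` S = T} =
      card {p. p permutes N \<and> p ` S = T} / fact (card N)"
    using finite_permutations[OF assms(1)] card_permutations[OF refl assms(1)]
    by (simp add: measure_pmf_of_set Int_def)
  also have "\<dots> = 1 / (card N choose card S)"
    using card_permutes_image[OF assms, THEN arg_cong, of real] pos
    by (simp add: field_simps)
  finally show ?thesis .
qed

section \<open>Counting the sets close to a given set\<close>

lemma sum_power_card_Pow:
  fixes x :: real
  assumes "finite N"
  shows "(\<Sum>P\<in>Pow N. x ^ card P) = (1 + x) ^ card N"
proof -
  have "(\<Sum>P\<in>Pow N. x ^ card P) = (\<Sum>P\<in>Pow N. (\<Prod>a\<in>P. x) * (\<Prod>a\<in>N-P. 1))" by simp
  also have "\<dots> = (\<Prod>a\<in>N. x + 1)"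
    using prod_add[OF assms, of "\<lambda>_. x" "\<lambda>_. 1"] by simp
  finally show ?thesis by (simp add: add.commute)
qed

text \<open>Markov's inequality for the weights \<open>\<mu> ^ card P\<close>, with \<open>\<mu> = t / (K * card N)\<close>.\<close>

lemma card_small_subsets_le:
  fixes K t :: nat
  assumes "finite N" "1 \<le> t" "t \<le> card N" "1 \<le> K"
  shows "real (card {P. P \<subseteq> N \<and> K * card P \<le> t})
    \<le> (exp 1 * real K * real (card N) / real t) powr (real t / real K)"
proof -
  define \<mu> where "\<mu> = real t / (real K * real (card N))"
  define s where "s = real t / real K"
  let ?M = "{P. P \<subseteq> N \<and> K * card P \<le> t}"
  have n: "card N > 0" using assms by linarith
  have "1 * real t \<le> real K * real (card N)" using assms by (intro mult_mono) auto
  then have \<mu>: "0 < \<mu>" "\<mu> \<le> 1" using assms n by (auto simp: \<mu>_def field_simps)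
  have fin: "finite (Pow N)" using assms by simp
  have "real (card ?M) * \<mu> powr s = (\<Sum>P\<in>?M. \<mu> powr s)" by simp
  also have "\<dots> \<le> (\<Sum>P\<in>?M. \<mu> ^ card P)"
  proof (rule sum_mono)
    fix P assume "P \<in> ?M"
    then have "real (K * card P) \<le> real t" by (simp only: of_nat_le_iff mem_Collect_eq)
    then have "real (card P) \<le> s" using assms by (simp add: s_def field_simps)
    \<comment> \<open>Since \<open>\<mu> \<le> 1\<close>, the power is antitone in its
      exponent.\<close>
    then have "\<mu> powr s \<le> \<mu> powr real (card P)" using \<mu> by (intro powr_mono') auto
    then show "\<mu> powr s \<le> \<mu> ^ card P" using \<mu> by (simp add: powr_realpow)
  qed
  also have "\<dots> \<le> (\<Sum>P\<in>Pow N. \<mu> ^ card P)"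
    using fin \<mu> by (intro sum_mono2) auto
  also have "\<dots> = (1 + \<mu>) ^ card N" by (rule sum_power_card_Pow[OF assms(1)])
  also have "\<dots> \<le> exp \<mu> ^ card N"
    using \<mu> by (intro power_mono) (auto simp: exp_ge_add_one_self)
  also have "\<dots> = exp (real (card N) * \<mu>)" by (rule exp_of_nat_mult[symmetric])
  \<comment> \<open>The choice of \<open>\<mu>\<close> makes this exponent \<open>s\<close>, so that
    \<open>exp s\<close> and \<open>\<mu> powr s\<close> merge into one power.\<close>
  also have "real (card N) * \<mu> = s" using n by (simp add: \<mu>_def s_def field_simps)
  finally have "real (card ?M) \<le> exp s / \<mu> powr s" using \<mu> by (simp add: field_simps)
  also have "\<dots> = (exp 1 / \<mu>) powr s"
    using \<mu> by (simp add: powr_divide) (simp add: powr_def)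
  also have "exp 1 / \<mu> = exp 1 * real K * real (card N) / real t"
    by (simp add: \<mu>_def)
  finally show ?thesis by (simp add: s_def)
qed

text \<open>The candidates for the image of \<open>S\<close> under a permutation of \<open>N\<close>
  that moves less than a fraction \<open>1 / K\<close> of \<open>S\<close> outside
  \<open>S\<close>.\<close>

definition near :: "nat \<Rightarrow> 'b set \<Rightarrow> 'b set \<Rightarrow> 'b set set" where
  "near K N S = {T. T \<subseteq> N \<and> card T = card S \<and> K * card (T - S) < card S}"

lemma finite_near [simp]: "finite N \<Longrightarrow> finite (near K N S)"
  by (auto simp: near_def)

text \<open>The strict bound forces \<open>T - S\<close> to be empty, and equal sizes then give
  \<open>T = S\<close>. For sizes up to \<open>K\<close>, almost invariance is therefore exact
  invariance.\<close>

lemma card_near_le_one: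
  assumes "finite N" "S \<subseteq> N" "card S \<le> K"
  shows "card (near K N S) \<le> 1"
proof -
  have "near K N S \<subseteq> {S}"
  proof
    fix T assume T: "T \<in> near K N S"
    have "K * card (T - S) < card S" using T by (simp add: near_def)
    with assms(3) have "K * card (T - S) < K" by (rule less_le_trans[rotated])
    then have "card (T - S) = 0" by (metis less_irrefl less_one mult.right_neutral mult_less_cancel1)
    moreover have fin: "finite T" "finite S" using T assms by (auto simp: near_def intro: finite_subset)
    ultimately have "T \<subseteq> S" by simp
    then have "T = S" using T fin by (simp add: near_def card_subset_eq)
    then show "T \<in> {S}" by simp
  qed
  then show ?thesis using card_mono[of "{S}" "near K N S"] by simp
qed

text \<open>A member \<open>T\<close> is determined by what it removes from \<open>S\<close> and
  what it adds from \<open>N\<close>. Equal sizes make both parts equally large, so each is counted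
  by \<open>card_small_subsets_le\<close>.\<close>

lemma card_near_le:
  assumes "finite N" "S \<subseteq> N" "1 \<le> card S" "1 \<le> K"
  shows "real (card (near K N S))
    \<le> (exp 2 * real K ^ 2 * real (card N) / real (card S)) powr (real (card S) / real K)"
proof -
  define t where "t = card S"
  define s where "s = real t / real K"
  have finS: "finite S" using assms finite_subset by blast
  have tn: "t \<le> card N" using assms by (simp add: t_def card_mono)
  have t: "1 \<le> t" using assms by (simp add: t_def)
  let ?A = "{P. P \<subseteq> S \<and> K * card P \<le> t}" and ?B = "{P. P \<subseteq> N \<and> K * card P \<le> t}"
  have "card (near K N S) \<le> card (?A \<times> ?B)"
  proof (rule card_inj_on_le)
    show "inj_on (\<lambda>T. (S - T, T - S)) (near K N S)"
      by (rule inj_onI) blast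
    show "(\<lambda>T. (S - T, T - S)) ` near K N S \<subseteq> ?A \<times> ?B"
    proof
      fix z assume "z \<in> (\<lambda>T. (S - T, T - S)) ` near K N S"
      then obtain T where T: "T \<in> near K N S" "z = (S - T, T - S)" by auto
      have finT: "finite T" using T assms by (auto simp: near_def intro: finite_subset)
      have "card (S - T) = card (T - S)"
        using T finT finS by (intro le_antisym card_le_sym_Diff) (auto simp: near_def)
      then show "z \<in> ?A \<times> ?B" using T by (auto simp: near_def t_def)
    qed
    show "finite (?A \<times> ?B)" using assms finS by auto
  qed
  then have "real (card (near K N S)) \<le> real (card ?A) * real (card ?B)"
    by (simp add: card_cartesian_product flip: of_nat_mult)
  also have "\<dots> \<le> (exp 1 * real K * real t / real t) powr s * (exp 1 * real K * real (card N) / real t) powr s"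
    unfolding s_def t_def using assms finS tn t
    by (intro mult_mono card_small_subsets_le) (auto simp: t_def)
  also have "\<dots> = (exp 2 * real K ^ 2 * real (card N) / real t) powr s"
    using t by (simp add: powr_mult[symmetric] power2_eq_square exp_double[of 1, simplified] mult_ac)
  finally show ?thesis by (simp add: s_def t_def)
qed

text \<open>This explains the value 64. With \<open>x = card N / card S \<ge> 2\<close>, the base in
  \<open>card_near_le\<close> is at most \<open>2 ^ 15 * x \<le> x ^ 16\<close>. The exponent
  \<open>card S / 64\<close> leaves \<open>x powr (card S / 4)\<close>, whose fourth power is below
  the binomial coefficient.\<close>

lemma near_power4_le_binomial:
  assumes "finite N" "S \<subseteq> N" "1 \<le> card S" "2 * card S \<le> card N"
  shows "real (card (near 64 N S)) ^ 4 \<le> real (card N choose card S)"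
proof -
  define t where "t = card S"
  define x where "x = real (card N) / real t"
  have t: "t \<ge> 1" using assms by (simp add: t_def)
  have x: "x \<ge> 2"
  proof -
    have "real (2 * t) \<le> real (card N)" using assms by (simp only: of_nat_le_iff t_def)
    then show ?thesis using t by (simp add: x_def field_simps)
  qed
  have "exp 2 = exp 1 * exp (1::real)" by (simp add: exp_add[symmetric])
  also have "\<dots> \<le> (2.8) * (2.8 :: real)"
    using e_less_272 by (intro mult_mono) auto
  finally have e2: "exp 2 \<le> (8::real)" by simp
  have "exp 2 * 64 ^ 2 * x \<le> 8 * 64 ^ 2 * x" using e2 x by (intro mult_right_mono) auto
  also have "\<dots> = 2 ^ 15 * x" by simp
  also have "\<dots> \<le> x ^ 15 * x" using x by (intro mult_right_mono power_mono) auto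
  also have "\<dots> = x ^ 16" by (simp add: power_Suc2[symmetric])
  finally have base: "exp 2 * 64 ^ 2 * x \<le> x ^ 16" .
  have "real (card (near 64 N S)) \<le> (exp 2 * 64 ^ 2 * x) powr (real t / 64)"
    using card_near_le[OF assms(1-3), of 64] by (simp add: x_def t_def)
  also have "\<dots> \<le> (x ^ 16) powr (real t / 64)"
    using base x by (intro powr_mono2) auto
  also have "x ^ 16 = x powr 16" using x by (simp add: powr_numeral)
  also have "\<dots> powr (real t / 64) = x powr (real t / 4)" by (simp only: powr_powr) simp
  finally have "real (card (near 64 N S)) ^ 4 \<le> (x powr (real t / 4)) ^ 4"
    by (intro power_mono) auto
  also have "\<dots> = (x powr (real t / 4)) powr 4" using x by (simp add: powr_numeral)
  also have "\<dots> = x powr real t" by (simp add: powr_powr)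
  also have "\<dots> = x ^ t" using x by (simp add: powr_realpow)
  also have "\<dots> \<le> real (card N choose t)"
    unfolding x_def using assms by (intro binomial_ge_n_over_k_pow_k) (simp add: t_def)
  finally show ?thesis by (simp add: t_def)
qed

lemma prob_permutes_near_le:
  assumes "finite N" "S \<subseteq> N"
  shows "measure_pmf.prob (pmf_of_set {p. p permutes N}) {p. K * card (p ` S - S) < card S}
    \<le> real (card (near K N S)) / real (card N choose card S)"
proof -
  let ?M = "pmf_of_set {p. p permutes N}"
  have ne: "{p. p permutes N} \<noteq> {}" using permutes_id by blast
  have img: "p ` S \<subseteq> N" if "p permutes N" for p
    using permutes_image[OF that] assms(2) by blast
  \<comment> \<open>Restricting to the support makes \<open>p\<close> a permutation, so that the
    image of \<open>S\<close> lies in \<open>N\<close>.\<close>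
  have "measure_pmf.prob ?M {p. K * card (p ` S - S) < card S}
      = measure_pmf.prob ?M ({p. K * card (p ` S - S) < card S} \<inter> set_pmf ?M)"
    by (simp add: measure_Int_set_pmf)
  also have "\<dots> \<le> measure_pmf.prob ?M (\<Union>T\<in>near K N S. {p. p ` S = T})"
  proof (intro measure_pmf.finite_measure_mono subsetI)
    fix p assume p: "p \<in> {p. K * card (p ` S - S) < card S} \<inter> set_pmf ?M"
    then have "p permutes N" using ne finite_permutations[OF assms(1)] by simp
    then have "p ` S \<in> near K N S"
      using p img by (simp add: near_def card_image permutes_inj_on)
    then show "p \<in> (\<Union>T\<in>near K N S. {p. p ` S = T})" by simp
  qed simp
  also have "\<dots> \<le> (\<Sum>T\<in>near K N S. measure_pmf.prob ?M {p. p ` S = T})"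
    using assms by (intro measure_pmf.finite_measure_subadditive_finite) auto
  also have "\<dots> = (\<Sum>T\<in>near K N S. 1 / real (card N choose card S))"
    using assms by (intro sum.cong refl prob_permutes_image) (auto simp: near_def)
  finally show ?thesis by simp
qed

text \<open>A transitive permutation is determined by the list \<open>p a, p (p a), \<dots>\<close> enumerating \<open>N - {a}\<close>.\<close>

lemma card_transitive_permutations_le:
  fixes N :: "'a set"
  assumes "finite N" "N \<noteq> {}"
  shows "card {p. p permutes N \<and> (\<forall>T\<subseteq>N. p ` T = T \<longrightarrow> T = {} \<or> T = N)} \<le> fact (card N - 1)"
proof -
  obtain a where a: "a \<in> N" using assms by blast
  define n where "n = card N"
  have n: "n > 0" using assms by (simp add: n_def card_gt_0_iff)
  define P where "P = {p. p permutes N \<and> (\<forall>T\<subseteq>N. p ` T = T \<longrightarrow> T = {} \<or> T = N)}"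
  define L where "L = {xs. length xs = n - 1 \<and> distinct xs \<and> set xs \<subseteq> N - {a}}"
  define F where "F = (\<lambda>p :: 'a \<Rightarrow> 'a. map (\<lambda>k. (p ^^ k) a) [1..<n])"
  have perm: "p permutes N" if "p \<in> P" for p using that by (simp add: P_def)
  have trans: "T = {} \<or> T = N" if "p \<in> P" "T \<subseteq> N" "p ` T = T" for p T
    using that by (simp add: P_def)
  have inj_pow: "inj (p ^^ i)" if "p \<in> P" for p i
    using perm[OF that] by (simp add: inj_fn permutes_inj)
  have in_N: "(p ^^ k) a \<in> N" if "p \<in> P" for p k
    using perm[OF that] a by (induction k) (simp_all add: permutes_in_image)
  have orbit: "range (\<lambda>k. (p ^^ k) a) = N" if p: "p \<in> P" for p
  proof -
    let ?T = "range (\<lambda>k. (p ^^ k) a)"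
    have sub: "?T \<subseteq> N" using in_N[OF p] by blast
    then have fin: "finite ?T" using assms(1) finite_subset by blast
    have "p ` ?T \<subseteq> ?T"
    proof
      fix y assume "y \<in> p ` ?T"
      then obtain k where "y = p ((p ^^ k) a)" by blast
      then have "y = (p ^^ Suc k) a" by simp
      then show "y \<in> ?T" by blast
    qed
    \<comment> \<open>Injectivity on a finite set turns forward closure into invariance, so
      transitivity applies to the orbit of \<open>a\<close>.\<close>
    moreover have "card (p ` ?T) = card ?T"
      using perm[OF p] by (intro card_image permutes_inj_on)
    ultimately have "p ` ?T = ?T" using fin by (simp add: card_subset_eq)
    then show ?thesis using trans[OF p sub] by blast
  qed
  \<comment> \<open>A return to \<open>a\<close> after \<open>d\<close> steps leaves at most
    \<open>d\<close> points in the orbit, which is all of \<open>N\<close>.\<close>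
  have no_period: "n \<le> d" if p: "p \<in> P" and d: "d > 0" "(p ^^ d) a = a" for p and d :: nat
  proof -
    have "N \<subseteq> (\<lambda>k. (p ^^ k) a) ` {..<d}"
    proof
      fix y assume "y \<in> N"
      then obtain k where "y = (p ^^ k) a" using orbit[OF p] by blast
      then have "y = (p ^^ (k mod d)) a" using d by (simp add: funpow_mod_eq)
      then show "y \<in> (\<lambda>k. (p ^^ k) a) ` {..<d}" using d by auto
    qed
    then have "card N \<le> card ((\<lambda>k. (p ^^ k) a) ` {..<d})" by (intro card_mono) auto
    also have "\<dots> \<le> d" using card_image_le[of "{..<d}" "\<lambda>k. (p ^^ k) a"] by simp
    finally show ?thesis by (simp add: n_def)
  qed
  have inj_lt: "(p ^^ i) a \<noteq> (p ^^ j) a" if p: "p \<in> P" and ij: "i < j" "j < n" for p i j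
  proof
    assume eq: "(p ^^ i) a = (p ^^ j) a"
    have "(p ^^ i) ((p ^^ (j - i)) a) = (p ^^ i) a"
      using eq ij by (simp add: funpow_add[THEN fun_cong, symmetric, unfolded comp_def])
    then have "(p ^^ (j - i)) a = a" using inj_pow[OF p, of i] by (simp add: inj_def)
    then show False using no_period[OF p, of "j - i"] ij by simp
  qed
  have inj_on: "inj_on (\<lambda>k. (p ^^ k) a) {..<n}" if "p \<in> P" for p
    by (intro linorder_inj_onI) (use inj_lt[OF that] in auto)
  have image: "(\<lambda>k. (p ^^ k) a) ` {..<n} = N" if "p \<in> P" for p
    using inj_on[OF that] in_N[OF that] assms(1)
    by (intro card_subset_eq) (auto simp: card_image n_def)
  \<comment> \<open>\<open>F\<close> records only the powers below \<open>n\<close>; the value of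
    \<open>p\<close> at the last point is recovered from the return to \<open>a\<close> at step
    \<open>n\<close>.\<close>
  have cycle: "(p ^^ n) a = a" if p: "p \<in> P" for p
  proof -
    obtain j where j: "j < n" "(p ^^ n) a = (p ^^ j) a" using image[OF p] in_N[OF p, of n] by auto
    have "(p ^^ j) ((p ^^ (n - j)) a) = (p ^^ j) a"
      using j by (simp add: funpow_add[THEN fun_cong, symmetric, unfolded comp_def])
    then have eq: "(p ^^ (n - j)) a = a" using inj_pow[OF p, of j] by (simp add: inj_def)
    then have "n \<le> n - j" using no_period[OF p, of "n - j"] j by simp
    then show ?thesis using eq n by (cases "j = 0") auto
  qed
  have "F ` P \<subseteq> L"
  proof
    fix xs assume "xs \<in> F ` P"
    then obtain p where p: "p \<in> P" "xs = F p" by blast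
    have "a \<notin> set xs" using inj_lt[OF p(1), of 0] by (force simp: p(2) F_def)
    moreover have "distinct xs"
      using inj_on[OF p(1)] by (auto simp: p(2) F_def distinct_map intro: inj_on_subset)
    moreover have "set xs \<subseteq> N" using in_N[OF p(1)] by (auto simp: p(2) F_def)
    moreover have "length xs = n - 1" by (simp add: p(2) F_def)
    ultimately show "xs \<in> L" by (auto simp: L_def)
  qed
  moreover have "inj_on F P"
  proof (rule inj_onI)
    fix p q assume pq: "p \<in> P" "q \<in> P" "F p = F q"
    have pow: "(p ^^ k) a = (q ^^ k) a" if "k \<le> n" for k
    proof -
      consider "k = 0" | "k = n" | "k \<in> set [1..<n]" using \<open>k \<le> n\<close> by fastforce
      then show ?thesis
        using pq(3) cycle[OF pq(1)] cycle[OF pq(2)] by cases (auto simp: F_def)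
    qed
    show "p = q"
    proof
      fix x show "p x = q x"
      proof (cases "x \<in> N")
        case True
        then obtain k where k: "k < n" "x = (p ^^ k) a" using image[OF pq(1)] by auto
        then show ?thesis using pow[of k] pow[of "Suc k"] by simp
      next
        case False
        then show ?thesis using perm[OF pq(1)] perm[OF pq(2)] by (simp add: permutes_not_in)
      qed
    qed
  qed
  moreover have "finite L"
    by (rule finite_subset[OF _ finite_lists_length_eq[of "N - {a}" "n - 1"]])
       (use assms in \<open>auto simp: L_def\<close>)
  ultimately have "card P \<le> card L" by (intro card_inj_on_le)
  also have "card L = \<Prod>{card (N - {a}) - (n - 1) + 1..card (N - {a})}"
    unfolding L_def using assms a by (intro card_lists_distinct_length_eq) (auto simp: n_def)
  also have "\<dots> = fact (n - 1)" using assms a by (simp add: n_def fact_prod)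
  finally show ?thesis by (simp add: P_def n_def)
qed

section \<open>Invariant and almost invariant sets of several random permutations\<close>

abbreviation uniform_perms :: "'e set \<Rightarrow> nat \<Rightarrow> ('e \<Rightarrow> nat \<Rightarrow> nat) pmf" where
  "uniform_perms B n \<equiv> Pi_pmf B id (\<lambda>_. pmf_of_set {p. p permutes {1..n}})"

lemma uniform_perms_permutes:
  assumes "finite B" "\<sigma> \<in> set_pmf (uniform_perms B n)" "e \<in> B"
  shows "\<sigma> e permutes {1..n}"
proof -
  let ?S = "{p. p permutes {1..n}}"
  have "\<sigma> \<in> PiE_dflt B id (set_pmf \<circ> (\<lambda>_. pmf_of_set ?S))"
    using set_Pi_pmf_subset'[OF assms(1), of id "\<lambda>_. pmf_of_set ?S"] assms(2) by blast
  then have "\<sigma> e \<in> set_pmf (pmf_of_set ?S)" using assms(3) by (simp add: PiE_dflt_def)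
  moreover have "finite ?S" "?S \<noteq> {}" using finite_permutations[of "{1..n}"] permutes_id by blast+
  ultimately show ?thesis by simp
qed

definition has_invariant_set :: "nat \<Rightarrow> 'e set \<Rightarrow> ('e \<Rightarrow> nat \<Rightarrow> nat) \<Rightarrow> bool" where
  "has_invariant_set n B \<sigma> \<longleftrightarrow>
     (\<exists>T\<subseteq>{1..n}. T \<noteq> {} \<and> 2 * card T \<le> n \<and> (\<forall>e\<in>B. \<sigma> e ` T = T))"

text \<open>After the gauge transformation the two notions enclose the event of small expansion: the
  exact one from inside, this one with \<open>K = 64\<close> from outside.\<close>

definition has_almost_invariant_set :: "nat \<Rightarrow> nat \<Rightarrow> 'e set \<Rightarrow> ('e \<Rightarrow> nat \<Rightarrow> nat) \<Rightarrow> bool" where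
  "has_almost_invariant_set K n B \<sigma> \<longleftrightarrow>
     (\<exists>T\<subseteq>{1..n}. T \<noteq> {} \<and> 2 * card T \<le> n \<and> (\<forall>e\<in>B. K * card (\<sigma> e ` T - T) < card T))"

text \<open>The left side is what the sets of size \<open>card S\<close> cost in the union bound. Up
  to size 64 the near family has at most one member, which leaves \<open>1 / c ^ (l - 1)\<close>,
  where \<open>c = n choose card S\<close> is \<open>n\<close> or at least of order
  \<open>n ^ 2\<close>. Larger sizes use \<open>b ^ 4 \<le> c\<close> for the size \<open>b\<close>
  of the near family.\<close>

lemma near_weight_le:
  fixes n l :: nat
  assumes "2 \<le> l" "S \<subseteq> {1..n}" "S \<noteq> {}" "2 * card S \<le> n"
  shows "real (n choose card S) * (real (card (near 64 {1..n} S)) / real (n choose card S)) ^ l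
    \<le> (if card S = 1 then 1 / real n ^ (l - 1)
        else if card S \<le> 64 then (4 / real n ^ 2) ^ (l - 1) else (8 / real n) ^ (2 * l))"
proof -
  define t c b where "t = card S" and "c = real (n choose t)" and "b = real (card (near 64 {1..n} S))"
  have finS: "finite S" using assms finite_subset by blast
  have t: "1 \<le> t" "2 * t \<le> n" using assms finS by (auto simp: t_def Suc_le_eq card_gt_0_iff)
  have n: "n \<ge> 2" using t by linarith
  have c: "c \<ge> 1" using t unfolding c_def by (simp add: Suc_le_eq)
  have l: "l = Suc (l - 1)" using assms(1) by simp
  have b0: "b \<ge> 0" by (simp add: b_def)
  have small: "c * (b / c) ^ l \<le> (1 / c) ^ (l - 1)" if "t \<le> 64"
  proof -
    have "b \<le> 1" using card_near_le_one[of "{1..n}" S 64] assms that by (simp add: b_def t_def)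
    then have "c * (b / c) ^ l \<le> c * (1 / c) ^ l"
      using c b0 by (intro mult_left_mono power_mono divide_right_mono) auto
    also have "\<dots> = c * ((1 / c) * (1 / c) ^ (l - 1))" by (subst l) simp
    also have "\<dots> = (1 / c) ^ (l - 1)" using c by simp
    finally show ?thesis .
  qed
  have main: "c * (b / c) ^ l \<le> (if t = 1 then 1 / real n ^ (l - 1)
        else if t \<le> 64 then (4 / real n ^ 2) ^ (l - 1) else (8 / real n) ^ (2 * l))"
  proof -
    consider "t = 1" | "t \<noteq> 1" "t \<le> 64" | "t > 64" by linarith
    then show ?thesis
    proof cases
      case 1
      then show ?thesis using small by (simp add: c_def power_one_over)
    next
      case 2
      have "(real n / real 2) ^ 2 \<le> real (n choose 2)"
        using n by (rule binomial_ge_n_over_k_pow_k)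
      also have "n choose 2 \<le> n choose t" using 2 t by (intro binomial_mono) auto
      then have "real (n choose 2) \<le> c" by (simp add: c_def)
      finally have "1 / c \<le> 1 / (real n / 2) ^ 2" using n c by (intro divide_left_mono) auto
      also have "\<dots> = 4 / real n ^ 2" by (simp add: power_divide)
      finally have "1 / c \<le> 4 / real n ^ 2" .
      then have "(1 / c) ^ (l - 1) \<le> (4 / real n ^ 2) ^ (l - 1)"
        using c by (intro power_mono) auto
      then show ?thesis using small 2 by simp
    next
      case 3
      \<comment> \<open>The lower bound \<open>x ^ 8\<close> for \<open>c\<close> yields
        \<open>x ^ (2 * l)\<close> after a fourth root, which still beats \<open>n ^ l\<close> when
        a factor \<open>n\<close> is lost by summing over the sizes.\<close>
      define x where "x = real n / 8"
      have "x ^ 8 \<le> real (n choose 8)"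
        unfolding x_def using 3 t binomial_ge_n_over_k_pow_k[of 8 n, where ?'a = real] by simp
      also have "n choose 8 \<le> n choose t" using 3 t by (intro binomial_mono) auto
      then have "real (n choose 8) \<le> c" by (simp add: c_def)
      finally have xc: "x ^ 8 \<le> c" .
      have x: "x > 0" using n by (simp add: x_def)
      have b4: "b ^ 4 \<le> c"
        using near_power4_le_binomial[of "{1..n}" S] assms t by (simp add: b_def c_def t_def)
      \<comment> \<open>Fourth powers keep all exponents natural, and the factor
        \<open>c ^ (4 * l)\<close> clears the denominators.\<close>
      have "(c * (b / c) ^ l) ^ 4 * c ^ (4 * l) = c ^ 4 * (b ^ 4) ^ l"
        using c by (simp add: power_divide power_mult_distrib flip: power_mult) (simp add: mult.commute)
      also have "\<dots> \<le> c ^ 4 * c ^ l"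
        using c b4 by (intro mult_left_mono power_mono) auto
      also have "\<dots> = c ^ (4 + l)" by (simp add: power_add)
      finally have "(c * (b / c) ^ l) ^ 4 * c ^ (4 * l) * c ^ l \<le> c ^ (4 + l) * c ^ l"
        using c by (intro mult_right_mono) auto
      also have "\<dots> = c ^ (4 + l + l)" by (simp only: power_add)
      \<comment> \<open>Here \<open>2 \<le> l\<close> enters, through
        \<open>4 + l + l \<le> 4 * l\<close>.\<close>
      also have "\<dots> \<le> c ^ (4 * l)" using c assms(1) by (intro power_increasing) auto
      finally have "((c * (b / c) ^ l) ^ 4 * c ^ l) * c ^ (4 * l) \<le> 1 * c ^ (4 * l)"
        by (simp add: mult_ac)
      then have "(c * (b / c) ^ l) ^ 4 * c ^ l \<le> 1"
        using c by (subst (asm) mult_le_cancel_right_pos) auto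
      moreover have "(c * (b / c) ^ l) ^ 4 * (x ^ 8) ^ l \<le> (c * (b / c) ^ l) ^ 4 * c ^ l"
        using xc x by (intro mult_left_mono power_mono) auto
      ultimately have "(c * (b / c) ^ l) ^ 4 * (x ^ 8) ^ l \<le> 1" by linarith
      then have "(c * (b / c) ^ l * x ^ (2 * l)) ^ 4 \<le> 1 ^ 4"
        by (simp add: power_mult_distrib mult.commute flip: power_mult)
      then have "c * (b / c) ^ l * x ^ (2 * l) \<le> 1"
        by (rule power_le_imp_le_base[of _ 3, simplified]) simp
      then have "c * (b / c) ^ l \<le> 1 / x ^ (2 * l)" using x by (simp add: field_simps)
      also have "\<dots> = (8 / real n) ^ (2 * l)" by (simp add: x_def power_divide)
      finally show ?thesis using 3 by simp
    qed
  qed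
  then show ?thesis unfolding t_def c_def b_def .
qed

section \<open>Probabilities of invariant and almost invariant sets\<close>

lemma prob_all_permutes:
  assumes "finite B"
  shows "measure_pmf.prob (uniform_perms B n) {\<sigma>. \<forall>e\<in>B. Q (\<sigma> e)}
    = measure_pmf.prob (pmf_of_set {p. p permutes {1..n}}) {p. Q p} ^ card B"
  using measure_Pi_pmf_Pi[OF assms, of id "\<lambda>_. pmf_of_set {p. p permutes {1..n}}" "\<lambda>_. {p. Q p}"]
  by (simp add: Pi_def Ball_def)

lemma prob_almost_invariant_le:
  assumes "finite B" "2 \<le> card B" "2 \<le> n"
  shows "measure_pmf.prob (uniform_perms B n) {\<sigma>. has_almost_invariant_set 64 n B \<sigma>}
    \<le> 1 / real n ^ (card B - 1) + (63 * 4 ^ card B + 64 ^ card B) / real n ^ card B"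
proof -
  define l where "l = card B"
  have l: "2 \<le> l" using assms by (simp add: l_def)
  let ?M = "uniform_perms B n" and ?U = "pmf_of_set {p. p permutes {1..n}}"
  define F where "F = {T. T \<subseteq> {1..n} \<and> T \<noteq> {} \<and> 2 * card T \<le> n}"
  define h where "h = (\<lambda>t. if t = 1 then 1 / real n ^ (l - 1)
        else if t \<le> (64::nat) then (4 / real n ^ 2) ^ (l - 1) else (8 / real n) ^ (2 * l))"
  have h0: "h t \<ge> 0" for t by (simp add: h_def)
  have finF: "finite F" by (simp add: F_def)
  have "measure_pmf.prob ?M {\<sigma>. has_almost_invariant_set 64 n B \<sigma>}
      = measure_pmf.prob ?M (\<Union>T\<in>F. {\<sigma>. \<forall>e\<in>B. 64 * card (\<sigma> e ` T - T) < card T})"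
    by (rule arg_cong[where f = "measure_pmf.prob ?M"])
       (auto simp: has_almost_invariant_set_def F_def)
  also have "\<dots> \<le> (\<Sum>T\<in>F. measure_pmf.prob ?M {\<sigma>. \<forall>e\<in>B. 64 * card (\<sigma> e ` T - T) < card T})"
    using finF by (intro measure_pmf.finite_measure_subadditive_finite) auto
  also have "\<dots> = (\<Sum>T\<in>F. measure_pmf.prob ?U {p. 64 * card (p ` T - T) < card T} ^ l)"
    unfolding l_def by (intro sum.cong refl prob_all_permutes assms)
  also have "\<dots> \<le> (\<Sum>T\<in>F. h (card T) / real (n choose card T))"
  proof (rule sum_mono)
    fix T assume T: "T \<in> F"
    let ?q = "real (card (near 64 {1..n} T)) / real (n choose card T)"
    have pos: "real (n choose card T) > 0" using T by (simp add: F_def)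
    have "measure_pmf.prob ?U {p. 64 * card (p ` T - T) < card T} ^ l \<le> ?q ^ l"
      using prob_permutes_near_le[of "{1..n}" T 64] T by (intro power_mono) (auto simp: F_def)
    also have "real (n choose card T) * ?q ^ l \<le> h (card T)"
      using near_weight_le[OF l, of T n] T by (simp add: F_def h_def)
    then have "?q ^ l \<le> h (card T) / real (n choose card T)"
      using pos by (simp add: field_simps)
    finally show "measure_pmf.prob ?U {p. 64 * card (p ` T - T) < card T} ^ l
      \<le> h (card T) / real (n choose card T)" .
  qed
  \<comment> \<open>Grouped by size, each of the at most \<open>n choose t\<close> sets contributes
    the same, and the binomial coefficient cancels.\<close>
  also have "\<dots> = (\<Sum>t\<in>{1..n}. \<Sum>T\<in>{T\<in>F. card T = t}. h (card T) / real (n choose card T))"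
  proof (rule sum.group[symmetric])
    have "card T \<in> {1..n}" if "T \<in> F" for T
    proof -
      have "finite T" "T \<noteq> {}" "2 * card T \<le> n" using that finite_subset[of T "{1..n}"] by (auto simp: F_def)
      then have "card T > 0" "card T \<le> n" by (auto simp: card_gt_0_iff)
      then show ?thesis by simp
    qed
    then show "card ` F \<subseteq> {1..n}" by blast
  qed (use finF in auto)
  also have "\<dots> \<le> (\<Sum>t\<in>{1..n}. h t)"
  proof (rule sum_mono)
    fix t assume t: "t \<in> {1..n}"
    have "card {T\<in>F. card T = t} \<le> card {T. T \<subseteq> {1..n} \<and> card T = t}"
      by (intro card_mono) (auto simp: F_def)
    also have "\<dots> = n choose t" using n_subsets[of "{1..n}" t] by simp
    finally have le: "real (card {T\<in>F. card T = t}) \<le> real (n choose t)" by simp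
    have "(\<Sum>T\<in>{T\<in>F. card T = t}. h (card T) / real (n choose card T))
      = real (card {T\<in>F. card T = t}) * (h t / real (n choose t))" by simp
    also have "\<dots> \<le> real (n choose t) * (h t / real (n choose t))"
      using le h0 by (intro mult_right_mono) auto
    also have "\<dots> = h t" using t by simp
    finally show "(\<Sum>T\<in>{T\<in>F. card T = t}. h (card T) / real (n choose card T)) \<le> h t" .
  qed
  \<comment> \<open>The range of sizes is enlarged so that the three regimes have 1, 63 and
    \<open>n\<close> terms for every \<open>n\<close>.\<close>
  also have "\<dots> \<le> (\<Sum>t\<in>insert 1 ({2..64} \<union> {65..64+n}). h t)"
    using h0 by (intro sum_mono2) auto
  also have "\<dots> = h 1 + ((\<Sum>t\<in>{2..64}. h t) + (\<Sum>t\<in>{65..64+n}. h t))"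
    by (subst sum.insert) (auto intro: sum.union_disjoint)
  also have "(\<Sum>t\<in>{2..64}. h t) = (\<Sum>t\<in>{2..64::nat}. (4 / real n ^ 2) ^ (l - 1))"
    by (intro sum.cong) (auto simp: h_def)
  also have "(\<Sum>t\<in>{65..64+n}. h t) = (\<Sum>t\<in>{65..64+n}. (8 / real n) ^ (2 * l))"
    by (intro sum.cong) (auto simp: h_def)
  also have "(\<Sum>t\<in>{2..64::nat}. (4 / real n ^ 2) ^ (l - 1)) = 63 * (4 / real n ^ 2) ^ (l - 1)"
    by simp
  also have "(\<Sum>t\<in>{65..64+n}. (8 / real n) ^ (2 * l)) = real n * (8 / real n) ^ (2 * l)"
    by simp
  also have "h 1 + (63 * (4 / real n ^ 2) ^ (l - 1) + real n * (8 / real n) ^ (2 * l))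
      \<le> h 1 + (63 * (4 ^ l / real n ^ l) + 64 ^ l / real n ^ l)"
  proof (intro add_mono mult_left_mono order_refl)
    show "(4 / real n ^ 2) ^ (l - 1) \<le> 4 ^ l / real n ^ l"
    proof -
      have "(4 / real n ^ 2) ^ (l - 1) = 4 ^ (l - 1) / real n ^ (2 * (l - 1))"
        by (simp add: power_divide power_mult)
      also have "\<dots> \<le> 4 ^ l / real n ^ l"
        using l assms(3) by (intro frac_le power_increasing) auto
      finally show ?thesis .
    qed
    show "real n * (8 / real n) ^ (2 * l) \<le> 64 ^ l / real n ^ l"
    proof -
      have "2 * l = Suc (2 * l - 1)" using l by simp
      then have "real n ^ (2 * l) = real n * real n ^ (2 * l - 1)" by (metis power_Suc)
      then have "real n * (8 / real n) ^ (2 * l) = 64 ^ l / real n ^ (2 * l - 1)"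
        using assms(3) by (simp add: power_divide) (simp add: power_mult)
      also have "\<dots> \<le> 64 ^ l / real n ^ l"
        using l assms(3) by (intro frac_le power_increasing) auto
      finally show ?thesis .
    qed
  qed simp
  also have "h 1 + (63 * (4 ^ l / real n ^ l) + 64 ^ l / real n ^ l)
      = 1 / real n ^ (card B - 1) + (63 * 4 ^ card B + 64 ^ card B) / real n ^ card B"
    by (simp add: h_def l_def add_divide_distrib)
  finally show ?thesis .
qed

text \<open>Second Bonferroni inequality with a cruder factor: a new event meets the earlier union
  with probability at most \<open>card I * b\<close>, and
  \<open>k ^ 2 + k \<le> (k + 1) ^ 2\<close>.\<close>

lemma prob_UN_ge:
  assumes "finite I" "\<And>i j. i \<in> I \<Longrightarrow> j \<in> I \<Longrightarrow> i \<noteq> j \<Longrightarrow> measure_pmf.prob M (E i \<inter> E j) \<le> b" "0 \<le> b"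
  shows "measure_pmf.prob M (\<Union>i\<in>I. E i)
    \<ge> (\<Sum>i\<in>I. measure_pmf.prob M (E i)) - real (card I) ^ 2 * b"
  using assms(1,2)
proof (induction I rule: finite_induct)
  case (insert x I)
  let ?U = "\<Union>i\<in>I. E i"
  have "measure_pmf.prob M (E x \<inter> ?U) = measure_pmf.prob M (\<Union>i\<in>I. E x \<inter> E i)" by simp
  also have "\<dots> \<le> (\<Sum>i\<in>I. measure_pmf.prob M (E x \<inter> E i))"
    using insert.hyps by (intro measure_pmf.finite_measure_subadditive_finite) auto
  also have "\<dots> \<le> (\<Sum>i\<in>I. b)"
    using insert.hyps by (intro sum_mono insert.prems) auto
  finally have int: "measure_pmf.prob M (E x \<inter> ?U) \<le> real (card I) * b" by simp
  have "measure_pmf.prob M (\<Union>i\<in>insert x I. E i) = measure_pmf.prob M (E x \<union> ?U)" by simp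
  also have "\<dots> = measure_pmf.prob M (E x) + measure_pmf.prob M ?U - measure_pmf.prob M (E x \<inter> ?U)"
    by (rule measure_Un3) (auto simp: measure_pmf.fmeasurable_eq_sets)
  finally have "measure_pmf.prob M (\<Union>i\<in>insert x I. E i)
      \<ge> measure_pmf.prob M (E x) + ((\<Sum>i\<in>I. measure_pmf.prob M (E i)) - real (card I) ^ 2 * b)
        - real (card I) * b"
    using insert.IH insert.prems int by fastforce
  moreover have "real (card (insert x I)) ^ 2 * b
      = real (card I) ^ 2 * b + real (card I) * b + (real (card I) + 1) * b"
    using insert.hyps by (simp add: power2_eq_square algebra_simps)
  moreover have "(real (card I) + 1) * b \<ge> 0" using assms(3) by simp
  ultimately show ?case using insert.hyps by simp
qed simp

text \<open>Common fixed points alone reach the main term: \<open>n\<close> singletons of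
  probability \<open>1 / n ^ l\<close> each, corrected by \<open>prob_UN_ge\<close>.\<close>

lemma prob_invariant_ge:
  assumes "finite B" "2 \<le> card B" "2 \<le> n"
  shows "measure_pmf.prob (uniform_perms B n) {\<sigma>. has_invariant_set n B \<sigma>}
    \<ge> 1 / real n ^ (card B - 1) - 4 ^ card B / real n ^ card B"
proof -
  define l where "l = card B"
  have l: "2 \<le> l" "l = Suc (l - 1)" using assms by (auto simp: l_def)
  let ?M = "uniform_perms B n"
  define E where "E = (\<lambda>T. {\<sigma> :: 'a \<Rightarrow> nat \<Rightarrow> nat. \<forall>e\<in>B. \<sigma> e ` T = T})"
  have prob: "measure_pmf.prob ?M (E T) = (1 / real (n choose card T)) ^ l" if "T \<subseteq> {1..n}" for T
    unfolding E_def l_def using prob_permutes_image[of "{1..n}" T T] that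
    by (subst prob_all_permutes[OF assms(1)]) simp
  have pair: "measure_pmf.prob ?M (E {i} \<inter> E {j}) \<le> (4 / real n ^ 2) ^ l"
    if "i \<in> {1..n}" "j \<in> {1..n}" "i \<noteq> j" for i j
  proof -
    \<comment> \<open>Two fixed points are weakened to an invariant pair, whose probability comes
      from \<open>prob_permutes_image\<close>.\<close>
    have "measure_pmf.prob ?M (E {i} \<inter> E {j}) \<le> measure_pmf.prob ?M (E {i, j})"
      by (intro measure_pmf.finite_measure_mono) (auto simp: E_def)
    also have "\<dots> = (1 / real (n choose 2)) ^ l"
      using that by (subst prob) (auto simp: card_insert_if numeral_2_eq_2)
    also have "\<dots> \<le> (4 / real n ^ 2) ^ l"
    proof (rule power_mono)
      have "(real n / real 2) ^ 2 \<le> real (n choose 2)"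
        using assms(3) by (rule binomial_ge_n_over_k_pow_k)
      then have "1 / real (n choose 2) \<le> 1 / (real n / 2) ^ 2"
        using assms(3) by (intro divide_left_mono) auto
      then show "1 / real (n choose 2) \<le> 4 / real n ^ 2" by (simp add: power_divide)
    qed simp
    finally show ?thesis .
  qed
  have "real n * (1 / real n) ^ l = 1 / real n ^ (l - 1)"
    using assms(3) by (subst l(2)) (simp add: power_one_over)
  moreover have "real n ^ 2 * (4 / real n ^ 2) ^ l \<le> 4 ^ l / real n ^ l"
  proof -
    have "real n ^ 2 * (4 / real n ^ 2) ^ l = real n ^ 2 * ((4 / real n ^ 2) * (4 / real n ^ 2) ^ (l - 1))"
      by (metis l(2) power_Suc)
    also have "\<dots> = 4 * (4 / real n ^ 2) ^ (l - 1)" using assms(3) by simp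
    also have "\<dots> = 4 * 4 ^ (l - 1) / real n ^ (2 * (l - 1))" by (simp add: power_divide power_mult)
    also have "4 * 4 ^ (l - 1) = (4::real) ^ l" by (metis l(2) power_Suc)
    also have "4 ^ l / real n ^ (2 * (l - 1)) \<le> 4 ^ l / real n ^ l"
      using l assms(3) by (intro frac_le power_increasing) auto
    finally show ?thesis .
  qed
  moreover have "measure_pmf.prob ?M (\<Union>i\<in>{1..n}. E {i})
      \<ge> (\<Sum>i\<in>{1..n}. measure_pmf.prob ?M (E {i})) - real (card {1..n}) ^ 2 * (4 / real n ^ 2) ^ l"
    using pair by (intro prob_UN_ge) auto
  moreover have "(\<Sum>i\<in>{1..n}. measure_pmf.prob ?M (E {i})) = (\<Sum>i\<in>{1..n}. (1 / real n) ^ l)"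
    by (intro sum.cong refl) (subst prob, auto)
  moreover have "measure_pmf.prob ?M (\<Union>i\<in>{1..n}. E {i})
      \<le> measure_pmf.prob ?M {\<sigma>. has_invariant_set n B \<sigma>}"
  proof (intro measure_pmf.finite_measure_mono subsetI)
    fix \<sigma> assume "\<sigma> \<in> (\<Union>i\<in>{1..n}. E {i})"
    then obtain i where "i \<in> {1..n}" "\<forall>e\<in>B. \<sigma> e ` {i} = {i}" by (auto simp: E_def)
    then show "\<sigma> \<in> {\<sigma>. has_invariant_set n B \<sigma>}"
      using assms(3) unfolding has_invariant_set_def by (intro CollectI exI[of _ "{i}"]) auto
  qed simp
  ultimately show ?thesis by (simp add: l_def)
qed

text \<open>A set and its complement are invariant together, and one of them has at most
  \<open>n / 2\<close> elements. Without small invariant sets the permutation is thus transitive,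
  which at most \<open>fact (n - 1)\<close> permutations are.\<close>

lemma prob_no_invariant_set_le:
  assumes "card B = 1" "1 \<le> n"
  shows "measure_pmf.prob (uniform_perms B n) {\<sigma>. \<not> has_invariant_set n B \<sigma>} \<le> 1 / real n"
proof -
  obtain e where B: "B = {e}" using assms(1) card_1_singletonE by blast
  let ?M = "uniform_perms B n" and ?S = "{p. p permutes {1..n}}"
  define Q where "Q = (\<lambda>p :: nat \<Rightarrow> nat. \<forall>T\<subseteq>{1..n}. p ` T = T \<longrightarrow> T = {} \<or> T = {1..n})"
  have ne: "?S \<noteq> {}" using permutes_id by blast
  have fin: "finite ?S" by (rule finite_permutations) simp
  have "measure_pmf.prob ?M {\<sigma>. \<not> has_invariant_set n B \<sigma>}
      = measure_pmf.prob ?M ({\<sigma>. \<not> has_invariant_set n B \<sigma>} \<inter> set_pmf ?M)"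
    by (simp add: measure_Int_set_pmf)
  also have "\<dots> \<le> measure_pmf.prob ?M {\<sigma>. \<forall>e\<in>B. Q (\<sigma> e)}"
  proof (intro measure_pmf.finite_measure_mono subsetI)
    fix \<sigma> assume \<sigma>: "\<sigma> \<in> {\<sigma>. \<not> has_invariant_set n B \<sigma>} \<inter> set_pmf ?M"
    then have perm: "\<sigma> e permutes {1..n}"
      using uniform_perms_permutes[of B \<sigma> n e] by (simp add: B)
    have "T = {} \<or> T = {1..n}" if T: "T \<subseteq> {1..n}" "\<sigma> e ` T = T" for T
    proof (rule ccontr)
      assume neither: "\<not> (T = {} \<or> T = {1..n})"
      define T' where "T' = {1..n} - T"
      have "\<sigma> e ` T' = T'"
        using T perm by (simp add: T'_def image_set_diff permutes_inj permutes_image)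
      moreover have "T' \<noteq> {}" "T' \<subseteq> {1..n}" using neither T by (auto simp: T'_def)
      moreover have "card T + card T' = n"
        using card_Un_disjoint[of T T'] T finite_subset[OF T(1)]
        by (simp add: T'_def Un_absorb1)
      then have "2 * card T \<le> n \<or> 2 * card T' \<le> n" by linarith
      ultimately have "has_invariant_set n B \<sigma>"
        using neither T unfolding has_invariant_set_def B by blast
      then show False using \<sigma> by blast
    qed
    then show "\<sigma> \<in> {\<sigma>. \<forall>e\<in>B. Q (\<sigma> e)}" by (simp add: Q_def B)
  qed simp
  also have "\<dots> = measure_pmf.prob (pmf_of_set ?S) {p. Q p}"
    using prob_all_permutes[of B n Q] assms(1) by (simp add: B)
  also have "\<dots> = real (card {p. p permutes {1..n} \<and> Q p}) / fact n"
    using ne fin card_permutations[of "{1..n}" n] by (simp add: measure_pmf_of_set Int_def)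
  also have "\<dots> \<le> fact (n - 1) / fact n"
  proof (rule divide_right_mono)
    have "card {p. p permutes {1..n} \<and> Q p} \<le> fact (n - 1)"
      using card_transitive_permutations_le[of "{1..n}"] assms(2) unfolding Q_def by simp
    then have "real (card {p. p permutes {1..n} \<and> Q p}) \<le> real (fact (n - 1))"
      by (simp only: of_nat_le_iff)
    then show "real (card {p. p permutes {1..n} \<and> Q p}) \<le> fact (n - 1)" by simp
  qed simp
  also have "\<dots> = 1 / real n" using assms(2) by (simp add: fact_reduce)
  finally show ?thesis .
qed

text \<open>For \<open>card B = 1\<close> the main term is 1, so the upper bound is trivial and the
  lower one is \<open>prob_no_invariant_set_le\<close>. Otherwise the larger of the two error
  constants serves both sides.\<close>

lemma prob_invariant_bounds:
  fixes B :: "'e set"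
  assumes "finite B" "1 \<le> card B"
  shows "\<exists>C. \<forall>n\<ge>2.
     1 / real n ^ (card B - 1) - C / real n ^ card B
       \<le> measure_pmf.prob (uniform_perms B n) {\<sigma>. has_invariant_set n B \<sigma>} \<and>
     measure_pmf.prob (uniform_perms B n) {\<sigma>. has_almost_invariant_set 64 n B \<sigma>}
       \<le> 1 / real n ^ (card B - 1) + C / real n ^ card B"
proof (cases "card B = 1")
  case True
  show ?thesis
  proof (intro exI[of _ 1] allI impI conjI)
    fix n :: nat assume n: "2 \<le> n"
    let ?M = "uniform_perms B n"
    have "measure_pmf.prob ?M {\<sigma>. \<not> has_invariant_set n B \<sigma>}
        = 1 - measure_pmf.prob ?M {\<sigma>. has_invariant_set n B \<sigma>}"
      using measure_pmf.prob_compl[of "{\<sigma>. has_invariant_set n B \<sigma>}" ?M]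
      by (simp add: Compl_eq_Diff_UNIV[symmetric] Collect_neg_eq)
    then show "1 / real n ^ (card B - 1) - 1 / real n ^ card B
       \<le> measure_pmf.prob ?M {\<sigma>. has_invariant_set n B \<sigma>}"
      using prob_no_invariant_set_le[OF True, of n] n True by simp
    have "measure_pmf.prob ?M {\<sigma>. has_almost_invariant_set 64 n B \<sigma>} \<le> 1"
      by (rule measure_pmf.prob_le_1)
    also have "1 \<le> 1 + 1 / real n ^ card B" by simp
    finally show "measure_pmf.prob ?M {\<sigma>. has_almost_invariant_set 64 n B \<sigma>}
       \<le> 1 / real n ^ (card B - 1) + 1 / real n ^ card B"
      using True by simp
  qed
next
  case False
  then have l: "2 \<le> card B" using assms by simp
  show ?thesis
  proof (intro exI[of _ "63 * 4 ^ card B + 64 ^ card B"] allI impI conjI)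
    fix n :: nat assume n: "2 \<le> n"
    have "4 ^ card B / real n ^ card B \<le> (63 * 4 ^ card B + 64 ^ card B) / real n ^ card B"
      by (intro divide_right_mono) auto
    then show "1 / real n ^ (card B - 1) - (63 * 4 ^ card B + 64 ^ card B) / real n ^ card B
       \<le> measure_pmf.prob (uniform_perms B n) {\<sigma>. has_invariant_set n B \<sigma>}"
      using prob_invariant_ge[OF assms(1) l n] by linarith
  qed (rule prob_almost_invariant_le[OF assms(1) l])
qed

section \<open>Gauge transformation along a spanning tree\<close>

text \<open>
  A spanning tree \<open>T\<close> of \<open>W\<close> (acyclicity is only expressed by its size), together with a relabelling
  \<open>g \<pi> v\<close> of the fibre over every vertex \<open>v\<close>, determined by the permutations along \<open>T\<close>, after which
  these permutations become the identity.
\<close>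

definition spanning_gauge ::
  "'a set \<Rightarrow> ('a \<times> 'a) set \<Rightarrow> (('a \<times> 'a \<Rightarrow> 'b \<Rightarrow> 'b) \<Rightarrow> 'a \<Rightarrow> 'b \<Rightarrow> 'b) \<Rightarrow> bool" where
  "spanning_gauge W T g \<longleftrightarrow>
     finite T \<and> T \<subseteq> W \<times> W \<and> card T + 1 = card W \<and>
     (\<forall>f :: 'a \<Rightarrow> bool. (\<forall>(u, v)\<in>T. f u = f v) \<longrightarrow> (\<forall>u\<in>W. \<forall>v\<in>W. f u = f v)) \<and>
     (\<forall>\<pi> N. (\<forall>e\<in>T. \<pi> e permutes N) \<longrightarrow>
        (\<forall>v. g \<pi> v permutes N) \<and> (\<forall>(u, v)\<in>T. g \<pi> v = \<pi> (u, v) \<circ> g \<pi> u)) \<and>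
     (\<forall>\<pi> \<pi>'. (\<forall>e\<in>T. \<pi> e = \<pi>' e) \<longrightarrow> g \<pi> = g \<pi>')"

lemma spanning_gaugeD:
  assumes "spanning_gauge W T g"
  shows "finite T" "T \<subseteq> W \<times> W" "card T + 1 = card W"
    and "\<And>f u v. \<forall>(u, v)\<in>T. f u = f v \<Longrightarrow> u \<in> W \<Longrightarrow> v \<in> W \<Longrightarrow> f u = (f v :: bool)"
    and "\<And>\<pi> N v. \<forall>e\<in>T. \<pi> e permutes N \<Longrightarrow> g \<pi> v permutes N"
    and "\<And>\<pi> N. \<forall>e\<in>T. \<pi> e permutes N \<Longrightarrow> \<forall>(u, v)\<in>T. g \<pi> v = \<pi> (u, v) \<circ> g \<pi> u"
    and "\<And>\<pi> \<pi>'. \<forall>e\<in>T. \<pi> e = \<pi>' e \<Longrightarrow> g \<pi> = g \<pi>'"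
proof -
  note g = assms[unfolded spanning_gauge_def]
  show "finite T" by (rule g[THEN conjunct1])
  note g = g[THEN conjunct2]
  show "T \<subseteq> W \<times> W" by (rule g[THEN conjunct1])
  note g = g[THEN conjunct2]
  show "card T + 1 = card W" by (rule g[THEN conjunct1])
  note g = g[THEN conjunct2]
  show "f u = (f v :: bool)" if "\<forall>(u, v)\<in>T. f u = f v" "u \<in> W" "v \<in> W" for f u v
    using g[THEN conjunct1, THEN spec, THEN mp, OF that(1)] that(2,3) by blast
  note g = g[THEN conjunct2]
  show "g \<pi> v permutes N" if "\<forall>e\<in>T. \<pi> e permutes N" for \<pi> N v
    by (rule g[THEN conjunct1, THEN spec, THEN spec, THEN mp, OF that, THEN conjunct1, THEN spec])
  show "\<forall>(u, v)\<in>T. g \<pi> v = \<pi> (u, v) \<circ> g \<pi> u" if "\<forall>e\<in>T. \<pi> e permutes N" for \<pi> N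
    by (rule g[THEN conjunct1, THEN spec, THEN spec, THEN mp, OF that, THEN conjunct2])
  note g = g[THEN conjunct2]
  show "g \<pi> = g \<pi>'" if "\<forall>e\<in>T. \<pi> e = \<pi>' e" for \<pi> \<pi>'
    by (rule g[THEN spec, THEN spec, THEN mp, OF that])
qed

text \<open>The tree equation at \<open>e\<close> forces the relabelling over the new leaf
  \<open>y\<close>; an arc pointing away from \<open>y\<close> calls for the inverse.\<close>

lemma spanning_gauge_insert:
  fixes g :: "('a \<times> 'a \<Rightarrow> 'b \<Rightarrow> 'b) \<Rightarrow> 'a \<Rightarrow> 'b \<Rightarrow> 'b"
  assumes "finite W" "spanning_gauge W T g" "x \<in> W" "y \<notin> W" "e = (x, y) \<or> e = (y, x)"
  shows "\<exists>g' :: ('a \<times> 'a \<Rightarrow> 'b \<Rightarrow> 'b) \<Rightarrow> 'a \<Rightarrow> 'b \<Rightarrow> 'b. spanning_gauge (insert y W) (insert e T) g'"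
proof -
  note g = spanning_gaugeD[OF assms(2)]
  have T: "T \<subseteq> W \<times> W" by (rule g)
  have eT: "e \<notin> T" using T assms(4,5) by auto
  define g' where
    "g' = (\<lambda>\<pi>. (g \<pi>)(y := (if e = (x, y) then \<pi> e else inv (\<pi> e)) \<circ> g \<pi> x))"
  have old: "g' \<pi> v = g \<pi> v" if "v \<in> W" for \<pi> v
    using that assms(4) by (auto simp: g'_def)
  have "spanning_gauge (insert y W) (insert e T) g'"
    unfolding spanning_gauge_def
  proof (intro conjI allI impI)
    show "finite (insert e T)" "insert e T \<subseteq> insert y W \<times> insert y W"
      using g(1) T assms(3,5) by auto
    show "card (insert e T) + 1 = card (insert y W)" using g(1,3) assms(1,4) eT by simp
  next
    fix f :: "'a \<Rightarrow> bool" assume f: "\<forall>(u, v)\<in>insert e T. f u = f v"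
    then have "\<forall>u\<in>W. \<forall>v\<in>W. f u = f v" using g(4)[of f] by blast
    moreover have "f y = f x" using f assms(5) by auto
    ultimately show "\<forall>u\<in>insert y W. \<forall>v\<in>insert y W. f u = f v" using assms(3) by blast
  next
    fix \<pi> :: "'a \<times> 'a \<Rightarrow> 'b \<Rightarrow> 'b" and N v assume \<pi>: "\<forall>e\<in>insert e T. \<pi> e permutes N"
    then have "g \<pi> v permutes N" for v using g(5)[where N = N] by simp
    then show "g' \<pi> v permutes N"
      using \<pi> by (auto simp: g'_def intro!: permutes_compose permutes_inv)
  next
    fix \<pi> :: "'a \<times> 'a \<Rightarrow> 'b \<Rightarrow> 'b" and N assume \<pi>: "\<forall>e\<in>insert e T. \<pi> e permutes N"
    have "g' \<pi> v = \<pi> (u, v) \<circ> g' \<pi> u" if uv: "(u, v) \<in> insert e T" for u v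
    proof (cases "(u, v) = e")
      case True
      have inv: "\<pi> e \<circ> inv (\<pi> e) = id" using \<pi> permutes_inv_o(1) by blast
      show ?thesis
      proof (cases "e = (x, y)")
        case True
        then show ?thesis using \<open>(u, v) = e\<close> old[OF assms(3)] by (simp add: g'_def)
      next
        case False
        then have yx: "e = (y, x)" "u = y" "v = x" using assms(5) \<open>(u, v) = e\<close> by auto
        have "\<pi> (u, v) \<circ> g' \<pi> u = (\<pi> e \<circ> inv (\<pi> e)) \<circ> g \<pi> x"
          using False \<open>(u, v) = e\<close> yx by (simp add: g'_def o_assoc)
        then show ?thesis using inv yx old[OF assms(3)] by simp
      qed
    next
      case False
      then have "(u, v) \<in> T" using uv by simp
      moreover have "\<forall>(u, v)\<in>T. g \<pi> v = \<pi> (u, v) \<circ> g \<pi> u" using \<pi> by (intro g(6)[where N = N]) simp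
      ultimately have "g \<pi> v = \<pi> (u, v) \<circ> g \<pi> u" by blast
      moreover have "u \<in> W" "v \<in> W" using \<open>(u, v) \<in> T\<close> T by auto
      ultimately show ?thesis by (simp only: old)
    qed
    then show "\<forall>(u, v)\<in>insert e T. g' \<pi> v = \<pi> (u, v) \<circ> g' \<pi> u" by blast
  next
    fix \<pi> \<pi>' :: "'a \<times> 'a \<Rightarrow> 'b \<Rightarrow> 'b" assume eq: "\<forall>e\<in>insert e T. \<pi> e = \<pi>' e"
    then have "g \<pi> = g \<pi>'" by (intro g(7)) simp
    moreover have "\<pi> e = \<pi>' e" using eq by blast
    ultimately show "g' \<pi> = g' \<pi>'" by (simp only: g'_def)
  qed
  then show ?thesis by blast
qed

text \<open>The tree grows from a single vertex, one crossing arc at a time, until it reaches all of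
  \<open>V\<close>; \<open>crossing\<close> is connectivity in terms of cuts.\<close>

lemma ex_spanning_gauge:
  assumes "finite V" "V \<noteq> {}" "A \<subseteq> V \<times> V"
    and crossing: "\<And>W. W \<subset> V \<Longrightarrow> W \<noteq> {} \<Longrightarrow> \<exists>(u, v)\<in>A. (u \<in> W) \<noteq> (v \<in> W)"
  shows "\<exists>T (g :: ('a \<times> 'a \<Rightarrow> 'b \<Rightarrow> 'b) \<Rightarrow> 'a \<Rightarrow> 'b \<Rightarrow> 'b). T \<subseteq> A \<and> spanning_gauge V T g"
proof -
  have "\<exists>W T (g :: ('a \<times> 'a \<Rightarrow> 'b \<Rightarrow> 'b) \<Rightarrow> 'a \<Rightarrow> 'b \<Rightarrow> 'b). W \<subseteq> V \<and> card W = Suc k \<and> T \<subseteq> A \<and>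
      spanning_gauge W T g" if "k < card V" for k
    using that
  proof (induction k)
    case 0
    obtain v where "v \<in> V" using assms(2) by blast
    moreover have "spanning_gauge {v} {} (\<lambda>_ _. id)"
      by (simp add: spanning_gauge_def permutes_id)
    ultimately show ?case by (intro exI[of _ "{v}"] exI[of _ "{}"] exI) auto
  next
    case (Suc k)
    then obtain W T and g :: "('a \<times> 'a \<Rightarrow> 'b \<Rightarrow> 'b) \<Rightarrow> 'a \<Rightarrow> 'b \<Rightarrow> 'b"
      where W: "W \<subseteq> V" "card W = Suc k" "T \<subseteq> A" "spanning_gauge W T g" by auto
    have "W \<subset> V" "W \<noteq> {}" using W Suc.prems by auto
    then obtain u v where uv: "(u, v) \<in> A" "(u \<in> W) \<noteq> (v \<in> W)" using crossing by blast
    then obtain x y where xy: "x \<in> W" "y \<notin> W" "(u, v) = (x, y) \<or> (u, v) = (y, x)" by blast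
    have finW: "finite W" using W(1) assms(1) finite_subset by blast
    obtain g' :: "('a \<times> 'a \<Rightarrow> 'b \<Rightarrow> 'b) \<Rightarrow> 'a \<Rightarrow> 'b \<Rightarrow> 'b"
      where "spanning_gauge (insert y W) (insert (u, v) T) g'"
      using spanning_gauge_insert[OF finW W(4) xy] by blast
    moreover have "insert y W \<subseteq> V" using W(1) uv(1) xy(3) assms(3) by blast
    moreover have "card (insert y W) = Suc (Suc k)" using W(2) xy(2) finW by simp
    moreover have "insert (u, v) T \<subseteq> A" using W(3) uv(1) by blast
    ultimately show ?case by blast
  qed
  from this[of "card V - 1"] obtain W T and g :: "('a \<times> 'a \<Rightarrow> 'b \<Rightarrow> 'b) \<Rightarrow> 'a \<Rightarrow> 'b \<Rightarrow> 'b"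
    where W: "W \<subseteq> V" "card W = card V" "T \<subseteq> A" "spanning_gauge W T g"
    using assms(1,2) by (auto simp: card_gt_0_iff)
  then have "W = V" using assms(1) card_subset_eq by blast
  then show ?thesis using W by blast
qed

text \<open>The permutation of an arc in the new labels, where the fibre point
  \<open>(v, h v x)\<close> is called \<open>x\<close>.\<close>

definition gauge_transform ::
  "('a \<Rightarrow> 'b \<Rightarrow> 'b) \<Rightarrow> ('a \<times> 'a \<Rightarrow> 'b \<Rightarrow> 'b) \<Rightarrow> 'a \<times> 'a \<Rightarrow> 'b \<Rightarrow> 'b" where
  "gauge_transform h \<pi> e = inv (h (snd e)) \<circ> \<pi> e \<circ> h (fst e)"

text \<open>For a fixed relabelling the map is a bijection of the finite product of permutation
  sets, undone by the opposite compositions, and so preserves the uniform distribution.\<close>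

lemma map_pmf_gauge_transform_const:
  assumes "finite B" "\<And>v. h v permutes {1..n}"
  shows "map_pmf (\<lambda>\<pi> e. if e \<in> B then gauge_transform h \<pi> e else id) (uniform_perms B n)
    = uniform_perms B n"
proof -
  let ?S = "{p. p permutes {1..n}}"
  let ?P = "PiE_dflt B id (\<lambda>_. ?S)"
  let ?F = "\<lambda>\<pi> e. if e \<in> B then gauge_transform h \<pi> e else id"
  let ?F' = "\<lambda>\<pi> e. if e \<in> B then h (snd e) \<circ> \<pi> e \<circ> inv (h (fst e)) else id"
  have fin: "finite ?S" by (rule finite_permutations) simp
  have ne: "?S \<noteq> {}" using permutes_id by blast
  have invs: "inv (h v) \<circ> h v = id" "h v \<circ> inv (h v) = id" for v
    using permutes_inv_o[OF assms(2)] by auto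
  have c1: "h v \<circ> (inv (h v) \<circ> f) = f" "inv (h v) \<circ> (h v \<circ> f) = f" for v and f :: "nat \<Rightarrow> nat"
    using invs by (auto simp: o_assoc)
  have "bij_betw ?F ?P ?P"
  proof (rule bij_betw_byWitness[where f' = ?F'])
    show "\<forall>\<pi>\<in>?P. ?F' (?F \<pi>) = \<pi>" "\<forall>\<pi>\<in>?P. ?F (?F' \<pi>) = \<pi>"
      by (auto simp: PiE_dflt_def fun_eq_iff gauge_transform_def c1 invs comp_assoc
          permutes_inverses[OF assms(2)])
    show "?F ` ?P \<subseteq> ?P" "?F' ` ?P \<subseteq> ?P"
      using assms(2) by (auto simp: PiE_dflt_def gauge_transform_def intro!: permutes_compose permutes_inv)
  qed
  moreover have "finite ?P" using assms(1) fin by (intro finite_PiE_dflt) auto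
  moreover have "?P \<noteq> {}" using ne by simp
  ultimately show ?thesis
    using Pi_pmf_of_set[of B "\<lambda>_. ?S" id] assms(1) fin ne by (simp add: map_pmf_of_set_bij_betw)
qed

text \<open>The relabelling depends only on the tree permutations, which are independent of the
  others. Given them it is fixed, and the distribution from
  \<open>map_pmf_gauge_transform_const\<close> does not depend on their values.\<close>

lemma map_pmf_gauge_transform:
  assumes "finite A" "T \<subseteq> A" "spanning_gauge V T g"
  shows "map_pmf (\<lambda>\<pi> e. if e \<in> A - T then gauge_transform (g \<pi>) \<pi> e else id) (uniform_perms A n)
    = uniform_perms (A - T) n"
proof -
  let ?S = "{p. p permutes {1..n}}"
  let ?B = "A - T"
  define F where "F = (\<lambda>\<pi> e. if e \<in> ?B then gauge_transform (g \<pi>) \<pi> e else id)"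
  define h where "h = (\<lambda>(f :: 'a \<times> 'a \<Rightarrow> nat \<Rightarrow> nat, q) x. if x \<in> T then f x else q x)"
  have finT: "finite T" using assms finite_subset by blast
  note g = spanning_gaugeD[OF assms(3)]
  have "A = T \<union> ?B" using assms(2) by blast
  then have eq: "uniform_perms A n = map_pmf h (pair_pmf (uniform_perms T n) (uniform_perms ?B n))"
    using Pi_pmf_union[of T ?B id "\<lambda>_. pmf_of_set ?S"] finT assms(1) by (simp add: h_def)
  have "map_pmf F (uniform_perms A n)
      = bind_pmf (uniform_perms T n) (\<lambda>f. map_pmf (\<lambda>q. F (h (f, q))) (uniform_perms ?B n))"
    unfolding eq by (simp add: pair_pmf_def map_pmf_def bind_assoc_pmf bind_return_pmf)
  also have "\<dots> = bind_pmf (uniform_perms T n) (\<lambda>f. uniform_perms ?B n)"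
  proof (rule bind_pmf_cong[OF refl])
    fix f assume f: "f \<in> set_pmf (uniform_perms T n)"
    then have perm: "\<forall>e\<in>T. f e permutes {1..n}"
      using uniform_perms_permutes[OF finT f] by blast
    have gh: "g (h (f, q)) = g f" for q
    proof -
      have "\<forall>e\<in>T. h (f, q) e = f e" by (simp add: h_def)
      then show ?thesis by (rule g(7))
    qed
    have "(\<lambda>q. F (h (f, q))) = (\<lambda>q e. if e \<in> ?B then gauge_transform (g f) q e else id)"
      unfolding F_def gh by (auto simp: fun_eq_iff gauge_transform_def h_def)
    moreover have "\<And>v. g f v permutes {1..n}" using perm by (rule g(5))
    ultimately show "map_pmf (\<lambda>q. F (h (f, q))) (uniform_perms ?B n) = uniform_perms ?B n"
      using map_pmf_gauge_transform_const[of ?B "g f" n] assms(1) by (simp only: finite_Diff)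
  qed
  finally show ?thesis by (simp only: bind_pmf_const F_def)
qed

section \<open>Expansion of lifts\<close>

lemma pverts_lift_graph [simp]: "pverts (lift_graph G A n \<pi>) = pverts G \<times> {1..n}"
  by (simp add: lift_graph_def)

lemma edges_lift_graph:
  "edges (lift_graph G A n \<pi>) = {{(u, i), (v, \<pi> (u, v) i)} | u v i.
     (u, v) \<in> A \<and> i \<in> {1..n} \<and> \<pi> (u, v) i \<in> {1..n}}"
  unfolding edges_def lift_graph_def parcs_mk_symmetric
  by (auto simp: image_def insert_commute)

section \<open>Edge cuts and the minimum defining the expansion\<close>

lemma card_doubleton_Int_eq_1_iff:
  "p \<noteq> q \<Longrightarrow> card ({p, q} \<inter> S) = 1 \<longleftrightarrow> (p \<in> S) \<noteq> (q \<in> S)"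
  by (auto simp: Int_insert_left)

lemma edge_expansion_le:
  assumes "finite (pverts H)" "S \<subseteq> pverts H" "0 < card S" "2 * card S \<le> card (pverts H)"
  shows "edge_expansion H \<le> real (card (cut_edges H S)) / real (card S)"
proof -
  have "finite {S. S \<subseteq> pverts H \<and> 0 < card S \<and> real (card S) \<le> real (card (pverts H)) / 2}"
    by (rule finite_subset[of _ "Pow (pverts H)"]) (use assms(1) in auto)
  then show ?thesis
    unfolding edge_expansion_def using assms by (intro Min_le) auto
qed

lemma edge_expansion_attained:
  assumes "finite (pverts H)" "2 \<le> card (pverts H)"
  obtains S where "S \<subseteq> pverts H" "0 < card S" "2 * card S \<le> card (pverts H)"
    "edge_expansion H = real (card (cut_edges H S)) / real (card S)"
proof -
  let ?A = "{S. S \<subseteq> pverts H \<and> 0 < card S \<and> real (card S) \<le> real (card (pverts H)) / 2}"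
  let ?f = "\<lambda>S. real (card (cut_edges H S)) / real (card S)"
  have "finite ?A"
    by (rule finite_subset[of _ "Pow (pverts H)"]) (use assms(1) in auto)
  \<comment> \<open>Two vertices make singletons admissible, so the minimum is taken over a nonempty
    set.\<close>
  moreover obtain x where "x \<in> pverts H" using assms(2) by fastforce
  then have "{x} \<in> ?A" using assms(2) by auto
  ultimately have "edge_expansion H \<in> ?f ` ?A"
    unfolding edge_expansion_def by (intro Min_in) auto
  then obtain S where "S \<in> ?A" "edge_expansion H = ?f S" by blast
  then show thesis using that[of S] by auto
qed

text \<open>One fixed outcome of the random permutations, with a relabelling \<open>h\<close> that
  trivialises those on the tree. The assumption \<open>connected\<close> expresses that
  \<open>T\<close> spans \<open>G\<close>: a vertex property constant along \<open>T\<close> is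
  constant.\<close>

locale gauged_lift =
  fixes G :: "'a pair_pre_digraph" and A T :: "('a \<times> 'a) set" and n :: nat
    and \<pi> :: "'a \<times> 'a \<Rightarrow> nat \<Rightarrow> nat" and h :: "'a \<Rightarrow> nat \<Rightarrow> nat"
  assumes finite_verts: "finite (pverts G)" and verts_nonempty: "pverts G \<noteq> {}"
    and arcs: "A \<subseteq> pverts G \<times> pverts G" and no_loop: "(u, v) \<in> A \<Longrightarrow> u \<noteq> v"
    and tree: "T \<subseteq> A"
    and connected: "\<forall>(u, v)\<in>T. f u = f v \<Longrightarrow> u \<in> pverts G \<Longrightarrow> v \<in> pverts G \<Longrightarrow> f u = (f v :: bool)"
    and perm: "e \<in> A \<Longrightarrow> \<pi> e permutes {1..n}"
    and gauge: "h v permutes {1..n}"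
    and tree_gauge: "(u, v) \<in> T \<Longrightarrow> h v = \<pi> (u, v) \<circ> h u"
begin

abbreviation "H \<equiv> lift_graph G A n \<pi>"
abbreviation "\<sigma> \<equiv> gauge_transform h \<pi>"

lemma gauge_in [simp]: "h v x \<in> {1..n} \<longleftrightarrow> x \<in> {1..n}"
  by (rule permutes_in_image[OF gauge])

lemma gauge_eq [simp]: "h v x = h v y \<longleftrightarrow> x = y"
  using permutes_inj[OF gauge] by (simp add: inj_eq)

lemma gauge_ex: "\<exists>x. i = h v x"
  using permutes_surj[OF gauge, of v] by (metis surjE)

lemma gauge_sigma: "h v (\<sigma> (u, v) x) = \<pi> (u, v) (h u x)"
  by (simp add: gauge_transform_def permutes_inverses[OF gauge])

lemma sigma_permutes: "e \<in> A \<Longrightarrow> \<sigma> e permutes {1..n}"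
  unfolding gauge_transform_def by (intro permutes_compose permutes_inv gauge perm)

lemma sigma_tree: "(u, v) \<in> T \<Longrightarrow> \<sigma> (u, v) = id"
  using permutes_inv_o(2)[OF gauge] by (simp add: gauge_transform_def tree_gauge[symmetric] comp_assoc)

lemma edge_iff:
  "e \<in> edges H \<longleftrightarrow> (\<exists>u v x. (u, v) \<in> A \<and> x \<in> {1..n} \<and> e = {(u, h u x), (v, h v (\<sigma> (u, v) x))})"
proof
  assume "e \<in> edges H"
  then obtain u v i where uv: "(u, v) \<in> A" "i \<in> {1..n}" "e = {(u, i), (v, \<pi> (u, v) i)}"
    unfolding edges_lift_graph by blast
  obtain x where "i = h u x" using gauge_ex by blast
  then show "\<exists>u v x. (u, v) \<in> A \<and> x \<in> {1..n} \<and> e = {(u, h u x), (v, h v (\<sigma> (u, v) x))}"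
    using uv gauge_sigma gauge_in by metis
next
  assume "\<exists>u v x. (u, v) \<in> A \<and> x \<in> {1..n} \<and> e = {(u, h u x), (v, h v (\<sigma> (u, v) x))}"
  then obtain u v x where uv: "(u, v) \<in> A" "x \<in> {1..n}" "e = {(u, h u x), (v, \<pi> (u, v) (h u x))}"
    unfolding gauge_sigma by blast
  moreover have "h u x \<in> {1..n}" using uv(2) by (simp only: gauge_in)
  moreover have "\<pi> (u, v) (h u x) \<in> {1..n}"
    using permutes_in_image[OF perm[OF uv(1)]] calculation(4) by blast
  ultimately show "e \<in> edges H" unfolding edges_lift_graph by blast
qed

lemma finite_cut_edges: "finite (cut_edges H S)"
proof -
  have "edges H \<subseteq> Pow (pverts G \<times> {1..n})"
    using arcs unfolding edges_lift_graph by auto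
  then have "finite (edges H)" using finite_verts by (meson finite_Pow_iff finite_SigmaI finite_atLeastAtMost finite_subset)
  then show ?thesis by (simp add: cut_edges_def)
qed

lemma cut_edge_iff:
  assumes "(u, v) \<in> A" "x \<in> {1..n}"
  shows "{(u, h u x), (v, h v (\<sigma> (u, v) x))} \<in> cut_edges H S
    \<longleftrightarrow> ((u, h u x) \<in> S) \<noteq> ((v, h v (\<sigma> (u, v) x)) \<in> S)"
proof -
  have "(u, h u x) \<noteq> (v, h v (\<sigma> (u, v) x))" using no_loop[OF assms(1)] by simp
  note card = card_doubleton_Int_eq_1_iff[OF this, of S]
  have "{(u, h u x), (v, h v (\<sigma> (u, v) x))} \<in> edges H" using assms edge_iff by blast
  then show ?thesis unfolding cut_edges_def mem_Collect_eq card by (simp only: simp_thms)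
qed

text \<open>A copy of the invariant set \<open>R\<close>, in the new labels, is placed over every
  vertex. Tree arcs act as the identity and the others preserve \<open>R\<close>, so no edge is
  cut.\<close>

lemma edge_expansion_invariant:
  assumes "has_invariant_set n (A - T) \<sigma>"
  shows "edge_expansion H \<le> 0"
proof -
  obtain R where R: "R \<subseteq> {1..n}" "R \<noteq> {}" "2 * card R \<le> n" "\<And>e. e \<in> A - T \<Longrightarrow> \<sigma> e ` R = R"
    using assms unfolding has_invariant_set_def by blast
  have inv: "\<sigma> (u, v) x \<in> R \<longleftrightarrow> x \<in> R" if "(u, v) \<in> A" for u v x
  proof -
    have "\<sigma> (u, v) ` R = R"
      using R(4)[of "(u, v)"] sigma_tree[of u v] that by (cases "(u, v) \<in> T") auto
    then show ?thesis
      using permutes_inj[OF sigma_permutes[OF that]] by (metis inj_image_mem_iff)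
  qed
  define S where "S = (SIGMA v:pverts G. h v ` R)"
  have finR: "finite R" using R(1) finite_subset by blast
  have mem: "(v, h v x) \<in> S \<longleftrightarrow> x \<in> R" if "v \<in> pverts G" for v x
    using that by (auto simp: S_def)
  have "cut_edges H S = {}"
  proof (rule ccontr)
    assume "cut_edges H S \<noteq> {}"
    then obtain e where e: "e \<in> cut_edges H S" by blast
    then have "e \<in> edges H" by (simp add: cut_edges_def)
    then obtain u v x where uv: "(u, v) \<in> A" "x \<in> {1..n}" "e = {(u, h u x), (v, h v (\<sigma> (u, v) x))}"
      unfolding edge_iff by blast
    have "u \<in> pverts G" "v \<in> pverts G" using uv(1) arcs by auto
    then show False using e cut_edge_iff[OF uv(1,2), of S] inv[OF uv(1)] mem unfolding uv(3) by simp
  qed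
  moreover have "card S = card (pverts G) * card R"
    unfolding S_def using finite_verts finR
    by (simp add: card_image inj_on_def)
  then have "0 < card S" "2 * card S \<le> card (pverts H)"
    using R(2,3) finR finite_verts verts_nonempty by (auto simp: card_gt_0_iff card_cartesian_product)
  moreover have "S \<subseteq> pverts H"
  proof
    fix p assume "p \<in> S"
    then obtain v x where "p = (v, h v x)" "v \<in> pverts G" "x \<in> R" by (auto simp: S_def)
    moreover have "h v x \<in> {1..n}" using \<open>x \<in> R\<close> R(1) by (subst gauge_in) blast
    ultimately show "p \<in> pverts H" by simp
  qed
  ultimately show ?thesis
    using edge_expansion_le[of H S] finite_verts by simp
qed

text \<open>A minimising \<open>S\<close> with \<open>c\<close> cut edges has label sets
  \<open>U v\<close> over the vertices. Up to \<open>c\<close> labels they agree with one of them,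
  \<open>R\<close>, and each arc moves at most \<open>3 * c\<close> elements of \<open>R\<close> out
  of it. Both \<open>R\<close> and its complement are large against \<open>c\<close> or the smaller
  choice suffices: \<open>R\<close> is taken if it has at most \<open>n / 2\<close> elements, its
  complement otherwise.\<close>

lemma almost_invariant_of_edge_expansion:
  assumes n: "2 \<le> n" and small: "edge_expansion H < 1 / (200 * real (card (pverts G)))"
  shows "has_almost_invariant_set 64 n (A - T) \<sigma>"
proof -
  define m where "m = card (pverts G)"
  have m: "m > 0" using finite_verts verts_nonempty by (simp add: m_def card_gt_0_iff)
  have cardH: "card (pverts H) = m * n" by (simp add: m_def card_cartesian_product)
  have "1 * 2 \<le> m * n" using m n by (intro mult_le_mono) auto
  then obtain S where S: "S \<subseteq> pverts H" "0 < card S" "2 * card S \<le> m * n"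
    "edge_expansion H = real (card (cut_edges H S)) / real (card S)"
    using edge_expansion_attained[of H] finite_verts cardH by auto
  define c where "c = card (cut_edges H S)"
  have "real c / real (card S) < 1 / (200 * real m)" using small S(4) by (simp add: c_def m_def)
  then have "real (200 * m * c) < real (card S)" using S(2) m by (simp add: field_simps)
  then have cS: "200 * m * c < card S" by (simp only: of_nat_less_iff)
  define U where "U = (\<lambda>v. {x \<in> {1..n}. (v, h v x) \<in> S})"
  have finU [simp]: "finite (U v)" for v by (simp add: U_def)
  have "S = (SIGMA v:pverts G. h v ` U v)"
  proof (intro equalityI subrelI)
    fix v i assume vi: "(v, i) \<in> S"
    obtain x where x: "i = h v x" using gauge_ex by blast
    have "i \<in> {1..n}" "v \<in> pverts G" using vi S(1) by auto
    then have "x \<in> {1..n}" by (simp only: x gauge_in)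
    then have "x \<in> U v" using vi x by (simp add: U_def)
    then show "(v, i) \<in> (SIGMA v:pverts G. h v ` U v)" using x \<open>v \<in> pverts G\<close> by simp
  qed (auto simp: U_def)
  then have "card S = card (SIGMA v:pverts G. h v ` U v)" by (rule arg_cong)
  also have "\<dots> = (\<Sum>v\<in>pverts G. card (h v ` U v))"
    using finite_verts by (intro card_SigmaI) auto
  also have "\<dots> = (\<Sum>v\<in>pverts G. card (U v))"
    by (intro sum.cong refl card_image) (simp add: inj_on_def)
  finally have cardS: "card S = (\<Sum>v\<in>pverts G. card (U v))" .

  (* x in X lies in some U u but not in some U v, so the lift of a tree arc at height x is cut:
     up to card X \<le> c elements all the sets U v coincide. *)
  define X where "X = {x \<in> {1..n}. \<exists>u\<in>pverts G. \<exists>v\<in>pverts G. (x \<in> U u) \<noteq> (x \<in> U v)}"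
  have finX: "finite X" by (simp add: X_def)
  have "\<exists>e. e \<in> cut_edges H S \<and> (\<exists>u v. e = {(u, h u x), (v, h v x)})" if "x \<in> X" for x
  proof -
    have x: "x \<in> {1..n}" using that by (simp add: X_def)
    have "\<not> (\<forall>(u, v)\<in>T. (x \<in> U u) = (x \<in> U v))"
      using that connected[of "\<lambda>v. x \<in> U v"] unfolding X_def by blast
    then obtain u v where uv: "(u, v) \<in> T" "(x \<in> U u) \<noteq> (x \<in> U v)" by blast
    have "((u, h u x) \<in> S) \<noteq> ((v, h v (\<sigma> (u, v) x)) \<in> S)"
      using uv(2) x sigma_tree[OF uv(1)] by (simp add: U_def)
    then have "{(u, h u x), (v, h v (\<sigma> (u, v) x))} \<in> cut_edges H S"
      using cut_edge_iff[of u v x S] uv(1) tree x by blast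
    then show ?thesis using sigma_tree[OF uv(1)] by auto
  qed
  then have "\<forall>x\<in>X. \<exists>e. e \<in> cut_edges H S \<and> (\<exists>u v. e = {(u, h u x), (v, h v x)})" by blast
  from bchoice[OF this] obtain k where k: "\<forall>x\<in>X. k x \<in> cut_edges H S"
    "\<forall>x\<in>X. \<exists>u v. k x = {(u, h u x), (v, h v x)}" by blast
  have "inj_on k X"
  proof (rule inj_onI)
    fix x y assume xy: "x \<in> X" "y \<in> X" "k x = k y"
    obtain u v where kx: "k x = {(u, h u x), (v, h v x)}" using bspec[OF k(2) xy(1)] by (elim exE)
    obtain u' v' where ky: "k y = {(u', h u' y), (v', h v' y)}" using bspec[OF k(2) xy(2)] by (elim exE)
    \<comment> \<open>Both ends of \<open>k y\<close> carry the label \<open>y\<close>, so an end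
      shared with \<open>k x\<close> forces \<open>x = y\<close>.\<close>
    have "(u, h u x) \<in> k y" unfolding xy(3)[symmetric] kx by simp
    then show "x = y" unfolding ky by auto
  qed
  then have cardX: "card X \<le> c"
    unfolding c_def using k(1) finite_cut_edges by (intro card_inj_on_le) auto

  obtain r where r: "r \<in> pverts G" using verts_nonempty by blast
  define R where "R = U r"
  have R: "R \<subseteq> {1..n}" by (auto simp: R_def U_def)
  have finR: "finite R" by (simp add: R_def)
  have UR: "U v \<subseteq> R \<union> X" "R \<subseteq> U v \<union> X" if "v \<in> pverts G" for v
    using r that by (auto simp: R_def X_def U_def)
  have Ule: "card (U v) \<le> card R + c" "card R \<le> card (U v) + c" if "v \<in> pverts G" for v
  proof -
    have "card (U v) \<le> card (R \<union> X)" using UR(1)[OF that] finR finX by (intro card_mono) auto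
    also have "\<dots> \<le> card R + card X" by (rule card_Un_le)
    finally show "card (U v) \<le> card R + c" using cardX by linarith
    have "card R \<le> card (U v \<union> X)" using UR(2)[OF that] finX by (intro card_mono) auto
    also have "\<dots> \<le> card (U v) + card X" by (rule card_Un_le)
    finally show "card R \<le> card (U v) + c" using cardX by linarith
  qed
  have S_le: "card S \<le> m * (card R + c)"
    unfolding cardS m_def using Ule(1) sum_bounded_above[of "pverts G" "\<lambda>v. card (U v)" "card R + c"]
    by simp
  have "(\<Sum>v\<in>pverts G. card R) \<le> (\<Sum>v\<in>pverts G. card (U v) + c)" by (rule sum_mono) (rule Ule(2))
  then have S_ge: "m * card R \<le> card S + m * c" by (simp add: sum.distrib cardS m_def)
  \<comment> \<open>The constant 200 leaves \<open>199 * c < card R\<close>, above the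
    \<open>64 * (3 * c)\<close> needed below, with room for the \<open>2 * c\<close> lost on passing
    to the complement.\<close>
  have "200 * m * c = m * (200 * c)" by simp
  then have "m * (200 * c) < m * (card R + c)" using cS S_le by (metis less_le_trans)
  then have cR: "199 * c < card R" by simp
  have "m * (2 * card R) = 2 * (m * card R)" "m * (n + 2 * c) = m * n + 2 * (m * c)"
    by (simp_all add: distrib_left)
  then have "m * (2 * card R) \<le> m * (n + 2 * c)" using S_ge S(3) by linarith
  then have R_half: "2 * card R \<le> n + 2 * c" using m by simp

  have move: "card (\<sigma> e ` R - R) \<le> 3 * c" if e: "e \<in> A" for e
  proof -
    obtain u v where uv: "e = (u, v)" by fastforce
    have V: "u \<in> pverts G" "v \<in> pverts G" using e uv arcs by auto
    define Y where "Y = {x \<in> U u. \<sigma> e x \<notin> U v}"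
    have "card Y \<le> c"
      unfolding c_def
    proof (rule card_inj_on_le)
      \<comment> \<open>As \<open>u \<noteq> v\<close>, the end over \<open>u\<close> determines the
        label.\<close>
      show "inj_on (\<lambda>x. {(u, h u x), (v, h v (\<sigma> (u, v) x))}) Y"
        using no_loop e uv by (auto intro!: inj_onI simp: doubleton_eq_iff)
      show "(\<lambda>x. {(u, h u x), (v, h v (\<sigma> (u, v) x))}) ` Y \<subseteq> cut_edges H S"
      proof
        fix z assume "z \<in> (\<lambda>x. {(u, h u x), (v, h v (\<sigma> (u, v) x))}) ` Y"
        then obtain x where x: "x \<in> U u" "\<sigma> e x \<notin> U v" "z = {(u, h u x), (v, h v (\<sigma> (u, v) x))}"
          by (auto simp: Y_def)
        then have xn: "x \<in> {1..n}" "(u, h u x) \<in> S" by (auto simp: U_def)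
        then have "\<sigma> e x \<in> {1..n}" using permutes_in_image[OF sigma_permutes[OF e]] by blast
        then have "(v, h v (\<sigma> (u, v) x)) \<notin> S" using x(2) uv by (simp add: U_def)
        then show "z \<in> cut_edges H S" using cut_edge_iff[of u v x S] e uv xn x(3) by blast
      qed
    qed (rule finite_cut_edges)
    \<comment> \<open>An element of \<open>R\<close> leaves \<open>R\<close> only if it starts in
      \<open>X\<close>, lies in \<open>Y\<close> and so gives a cut edge, or arrives in
      \<open>X\<close>. Each case accounts for at most \<open>c\<close> elements.\<close>
    moreover have "\<sigma> e ` R - R \<subseteq> \<sigma> e ` X \<union> (\<sigma> e ` Y \<union> X)"
      using UR(2)[OF V(1)] UR(1)[OF V(2)] unfolding Y_def by blast
    then have "card (\<sigma> e ` R - R) \<le> card (\<sigma> e ` X \<union> (\<sigma> e ` Y \<union> X))"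
      using finX by (intro card_mono) (auto simp: Y_def)
    then have "card (\<sigma> e ` R - R) \<le> card (\<sigma> e ` X) + (card (\<sigma> e ` Y) + card X)"
      using card_Un_le[of "\<sigma> e ` X" "\<sigma> e ` Y \<union> X"] card_Un_le[of "\<sigma> e ` Y" X] by linarith
    moreover have "card (\<sigma> e ` X) \<le> card X" "card (\<sigma> e ` Y) \<le> card Y"
      using finX by (auto simp: Y_def intro: card_image_le)
    ultimately show ?thesis using cardX by linarith
  qed

  show ?thesis
  proof (cases "2 * card R \<le> n")
    case True
    have "64 * card (\<sigma> e ` R - R) < card R" if "e \<in> A - T" for e
      using move[of e] that cR by simp
    moreover have "R \<noteq> {}" using cR by auto
    ultimately show ?thesis unfolding has_almost_invariant_set_def using R True by blast
  next
    case False
    \<comment> \<open>By \<open>R_half\<close> the excess of \<open>R\<close> over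
      \<open>n / 2\<close> is at most \<open>c\<close>, so the complement is still large and can
      replace \<open>R\<close>.\<close>
    define R' where "R' = {1..n} - R"
    have cardR': "card R' = n - card R" using R finR by (simp add: R'_def card_Diff_subset)
    have big: "192 * c < card R'" using R_half cR False cardR' by linarith
    have "64 * card (\<sigma> e ` R' - R') < card R'" if "e \<in> A - T" for e
    proof -
      have perm: "\<sigma> e permutes {1..n}" using sigma_permutes that by blast
      then have "\<sigma> e ` R' = {1..n} - \<sigma> e ` R"
        by (simp add: R'_def image_set_diff permutes_inj permutes_image)
      \<comment> \<open>What leaves the complement is the part of \<open>R\<close> missed by its
        image, as large as the part of the image outside \<open>R\<close>.\<close>
      then have "\<sigma> e ` R' - R' = R - \<sigma> e ` R" using R by (auto simp: R'_def)
      moreover have "card (R - \<sigma> e ` R) \<le> card (\<sigma> e ` R - R)"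
        using finR perm by (intro card_le_sym_Diff) (auto simp: card_image permutes_inj_on)
      ultimately show ?thesis using move[of e] that big by simp
    qed
    moreover have "R' \<noteq> {}" using big by auto
    moreover have "2 * card R' \<le> n" using False cardR' by simp
    moreover have "R' \<subseteq> {1..n}" by (auto simp: R'_def)
    ultimately show ?thesis unfolding has_almost_invariant_set_def by blast
  qed
qed

end

section \<open>Connectivity, orientations and the final probability bound\<close>

lemma connected_crossing:
  assumes "Digraph_Component.connected (with_proj G)" "W \<subset> pverts G" "W \<noteq> {}"
  shows "\<exists>(u, v)\<in>parcs G. (u \<in> W) \<noteq> (v \<in> W)"
proof (rule ccontr)
  assume no: "\<not> ?thesis"
  obtain u v where uv: "u \<in> W" "v \<in> pverts G" "v \<notin> W" using assms(2,3) by blast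
  let ?M = "mk_symmetric (with_proj G)"
  have "u \<rightarrow>\<^sup>*\<^bsub>with_proj ?M\<^esub> v"
    using assms(1,2) uv unfolding connected_def strongly_connected_def by auto
  then have "(u, v) \<in> rtrancl_on (pverts G) (parcs ?M)" by (simp add: reachable_def)
  \<comment> \<open>If no arc crosses \<open>W\<close>, membership in \<open>W\<close> propagates
    along every path of the symmetric closure.\<close>
  then have "u \<in> W \<longrightarrow> v \<in> W"
    by (induction rule: rtrancl_on.induct) (use no in \<open>fastforce simp: parcs_mk_symmetric\<close>)+
  then show False using uv by blast
qed

text \<open>Forgetting directions is a bijection from \<open>A\<close> to the edges, as
  \<open>A\<close> contains exactly one arc of each opposite pair. The hypothesis on the number of
  edges thus counts the arcs outside a tree.\<close>

lemma card_orientation: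
  assumes "pair_graph G" "orientation G A"
  shows "card A = card (edges G)"
proof -
  interpret pair_graph G by fact
  have A: "A \<subseteq> parcs G" "\<And>u v. (u, v) \<in> parcs G \<Longrightarrow> (u, v) \<in> A \<longleftrightarrow> (v, u) \<notin> A"
    using assms(2) by (auto simp: orientation_def)
  have sym: "(v, u) \<in> parcs G" if "(u, v) \<in> parcs G" for u v
    using pair_sym_arcs that by (auto simp: symmetric_def dest: symD)
  have "inj_on (\<lambda>(u, v). {u, v}) A"
    using A by (auto simp: inj_on_def doubleton_eq_iff)
  moreover have "(\<lambda>(u, v). {u, v}) ` A = edges G"
  proof
    show "(\<lambda>(u, v). {u, v}) ` A \<subseteq> edges G" using A(1) by (auto simp: edges_def)
    show "edges G \<subseteq> (\<lambda>(u, v). {u, v}) ` A"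
    proof
      fix e assume "e \<in> edges G"
      then obtain u v where uv: "(u, v) \<in> parcs G" "e = {u, v}" by (auto simp: edges_def)
      show "e \<in> (\<lambda>(u, v). {u, v}) ` A"
      proof (cases "(u, v) \<in> A")
        case True
        then show ?thesis using uv(2) by (intro image_eqI[of _ _ "(u, v)"]) auto
      next
        case False
        then have "(v, u) \<in> A" using A(2) uv(1) by blast
        then show ?thesis using uv(2) by (intro image_eqI[of _ _ "(v, u)"]) auto
      qed
    qed
  qed
  ultimately show ?thesis using card_image by metis
qed

text \<open>On the support every outcome is a \<open>gauged_lift\<close>, so small expansion is
  enclosed between the two events of \<open>prob_invariant_bounds\<close>, and one error constant
  serves both sides.\<close>

lemma prob_edge_expansion_bounds:
  fixes G :: "'a pair_pre_digraph" and l :: nat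
  assumes "l \<ge> 1" "pair_graph G" "Digraph_Component.connected (with_proj G)"
    and "int (card (edges G)) - int (card (pverts G)) = int l - 1"
    and A: "orientation G A"
  shows "\<exists>C. \<forall>n\<ge>2.
    \<bar>measure_pmf.prob (random_lift G A n)
       {H. edge_expansion H \<ge> 1 / (200 * real (card (pverts G)))} - (1 - 1 / real n ^ (l - 1))\<bar>
      \<le> C / real n ^ l"
proof -
  interpret pair_graph G by fact
  define \<xi> where "\<xi> = 1 / (200 * real (card (pverts G)))"
  have V: "finite (pverts G)" "pverts G \<noteq> {}"
    using assms(3) pair_finite_verts by (auto simp: connected_def strongly_connected_def)
  have \<xi>: "\<xi> > 0" using V by (simp add: \<xi>_def card_gt_0_iff)
  have A': "A \<subseteq> parcs G" "\<And>u v. (u, v) \<in> parcs G \<Longrightarrow> (u, v) \<in> A \<longleftrightarrow> (v, u) \<notin> A"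
    using A by (auto simp: orientation_def)
  have arcs: "A \<subseteq> pverts G \<times> pverts G" using A'(1) by (intro subrelI) (auto dest: in_arcsD1 in_arcsD2)
  have no_loop: "u \<noteq> v" if "(u, v) \<in> A" for u v
    using pair_no_loops[of "(u, v)"] A'(1) that by auto
  have finA: "finite A" using A'(1) pair_finite_arcs finite_subset by blast
  have crossing: "\<exists>(u, v)\<in>A. (u \<in> W) \<noteq> (v \<in> W)" if W: "W \<subset> pverts G" "W \<noteq> {}" for W
  proof -
    obtain u v where uv: "(u, v) \<in> parcs G" "(u \<in> W) \<noteq> (v \<in> W)"
      using connected_crossing[OF assms(3) W] by blast
    then have "(u, v) \<in> A \<or> (v, u) \<in> A" using A'(2) by blast
    then show ?thesis using uv(2) by blast
  qed
  obtain T and g :: "('a \<times> 'a \<Rightarrow> nat \<Rightarrow> nat) \<Rightarrow> 'a \<Rightarrow> nat \<Rightarrow> nat"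
    where T: "T \<subseteq> A" and g: "spanning_gauge (pverts G) T g"
    using ex_spanning_gauge[OF V arcs crossing] by blast
  note gD = spanning_gaugeD[OF g]
  define B where "B = A - T"
  \<comment> \<open>The tree has \<open>card (pverts G) - 1\<close> arcs, so exactly
    \<open>l\<close> arcs remain outside it.\<close>
  have "card B + card T = card A"
    unfolding B_def using T gD(1) finA by (simp add: card_Diff_subset card_mono)
  then have cardB: "card B = l"
    using gD(3) assms(4) card_orientation[OF assms(2) A] by linarith
  have finB: "finite B" using finA by (simp add: B_def)
  obtain C where C: "\<forall>n\<ge>2. 1 / real n ^ (l - 1) - C / real n ^ l
       \<le> measure_pmf.prob (uniform_perms B n) {\<sigma>. has_invariant_set n B \<sigma>} \<and>
     measure_pmf.prob (uniform_perms B n) {\<sigma>. has_almost_invariant_set 64 n B \<sigma>}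
       \<le> 1 / real n ^ (l - 1) + C / real n ^ l"
    using prob_invariant_bounds[OF finB] assms(1) cardB by auto
  have "\<bar>measure_pmf.prob (random_lift G A n) {H. edge_expansion H \<ge> \<xi>} - (1 - 1 / real n ^ (l - 1))\<bar>
      \<le> C / real n ^ l" if n: "n \<ge> 2" for n
  proof -
    let ?M = "uniform_perms A n"
    define E where "E = {\<pi>. edge_expansion (lift_graph G A n \<pi>) < \<xi>}"
    define F where "F = (\<lambda>\<pi> e. if e \<in> B then gauge_transform (g \<pi>) \<pi> e else id)"
    have map: "map_pmf F ?M = uniform_perms B n"
      unfolding F_def B_def by (rule map_pmf_gauge_transform[OF finA T g])
    note supp = uniform_perms_permutes[OF finA]
    have lift: "gauged_lift G A T n \<pi> (g \<pi>)" if "\<pi> \<in> set_pmf ?M" for \<pi>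
    proof -
      have perm: "\<forall>e\<in>T. \<pi> e permutes {1..n}" using supp[OF that] T by blast
      show ?thesis
      proof
        show "g \<pi> v = \<pi> (u, v) \<circ> g \<pi> u" if "(u, v) \<in> T" for u v
          using gD(6)[OF perm] that by blast
        show "f u = (f v :: bool)"
          if "\<forall>(u, v)\<in>T. f u = f v" "u \<in> pverts G" "v \<in> pverts G" for f u v
          using gD(4) that .
      qed (use V arcs no_loop T supp[OF that] gD(5)[OF perm] in auto)
    qed
    \<comment> \<open>\<open>F\<close> differs from the gauge transform only outside
      \<open>B\<close>, where neither property looks.\<close>
    have inv_F: "has_invariant_set n B (F \<pi>) = has_invariant_set n B (gauge_transform (g \<pi>) \<pi>)"
      "has_almost_invariant_set 64 n B (F \<pi>) = has_almost_invariant_set 64 n B (gauge_transform (g \<pi>) \<pi>)" for \<pi>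
      by (simp_all add: has_invariant_set_def has_almost_invariant_set_def F_def)
    have "measure_pmf.prob (uniform_perms B n) {\<sigma>. has_invariant_set n B \<sigma>}
        = measure_pmf.prob ?M ({\<pi>. has_invariant_set n B (F \<pi>)} \<inter> set_pmf ?M)"
      unfolding map[symmetric] by (simp add: measure_Int_set_pmf vimage_def)
    also have "\<dots> \<le> measure_pmf.prob ?M E"
    proof (intro measure_pmf.finite_measure_mono subsetI)
      fix \<pi> assume \<pi>: "\<pi> \<in> {\<pi>. has_invariant_set n B (F \<pi>)} \<inter> set_pmf ?M"
      then have "has_invariant_set n B (gauge_transform (g \<pi>) \<pi>)" using inv_F(1) by blast
      then have "edge_expansion (lift_graph G A n \<pi>) \<le> 0"
        using gauged_lift.edge_expansion_invariant[OF lift] \<pi> unfolding B_def by blast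
      then show "\<pi> \<in> E" using \<xi> by (simp add: E_def)
    qed simp
    finally have lower: "measure_pmf.prob (uniform_perms B n) {\<sigma>. has_invariant_set n B \<sigma>}
        \<le> measure_pmf.prob ?M E" .
    have "measure_pmf.prob ?M E = measure_pmf.prob ?M (E \<inter> set_pmf ?M)"
      by (simp add: measure_Int_set_pmf)
    also have "\<dots> \<le> measure_pmf.prob ?M {\<pi>. has_almost_invariant_set 64 n B (F \<pi>)}"
    proof (intro measure_pmf.finite_measure_mono subsetI)
      fix \<pi> assume \<pi>: "\<pi> \<in> E \<inter> set_pmf ?M"
      then have "has_almost_invariant_set 64 n B (gauge_transform (g \<pi>) \<pi>)"
        using gauged_lift.almost_invariant_of_edge_expansion[OF lift n]
        unfolding B_def E_def \<xi>_def by blast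
      then show "\<pi> \<in> {\<pi>. has_almost_invariant_set 64 n B (F \<pi>)}" using inv_F(2) by blast
    qed simp
    also have "\<dots> = measure_pmf.prob (uniform_perms B n) {\<sigma>. has_almost_invariant_set 64 n B \<sigma>}"
      unfolding map[symmetric] by (simp add: vimage_def)
    finally have upper: "measure_pmf.prob ?M E
        \<le> measure_pmf.prob (uniform_perms B n) {\<sigma>. has_almost_invariant_set 64 n B \<sigma>}" .
    have "measure_pmf.prob (random_lift G A n) {H. edge_expansion H \<ge> \<xi>} = measure_pmf.prob ?M (- E)"
      unfolding random_lift_def E_def by (simp add: vimage_def Compl_eq not_less)
    also have "\<dots> = 1 - measure_pmf.prob ?M E"
      using measure_pmf.prob_compl[of E ?M] by (simp add: Compl_eq_Diff_UNIV)
    finally have "measure_pmf.prob (random_lift G A n) {H. edge_expansion H \<ge> \<xi>}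
        = 1 - measure_pmf.prob ?M E" .
    moreover note C[rule_format, OF n] lower upper
    ultimately show ?thesis by linarith
  qed
  then show ?thesis unfolding \<xi>_def by blast
qed

text \<open>The constant depends only on the number of vertices, so one value serves every
  orientation.\<close>

theorem theorem4p5:
  fixes G :: "'a pair_pre_digraph" and l :: nat
  assumes "l \<ge> 1"
    and "pair_graph G"
    and "Digraph_Component.connected (with_proj G)"
    and "int (card (edges G)) - int (card (pverts G)) = int l - 1"
  shows "\<exists>\<xi>>0. \<forall>A. orientation G A \<longrightarrow>
           (\<exists>r :: nat \<Rightarrow> real. r \<in> O(\<lambda>n. 1 / real n ^ l) \<and>
              (\<forall>n\<ge>3. measure_pmf.prob (random_lift G A n) {H. edge_expansion H \<ge> \<xi>}
                        = 1 - 1 / real n ^ (l - 1) + r n))"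
proof (intro exI[of _ "1 / (200 * real (card (pverts G)))"] conjI allI impI)
  have "pverts G \<noteq> {}" "finite (pverts G)"
    using assms(2,3) pair_fin_digraph.pair_finite_verts[of G]
    by (auto simp: connected_def strongly_connected_def pair_graph_def pair_digraph_def)
  then show "1 / (200 * real (card (pverts G))) > 0" by (simp add: card_gt_0_iff)
next
  fix A assume A: "orientation G A"
  \<comment> \<open>The remainder is the exact difference, so the equation is immediate and only its
    order is to be shown.\<close>
  define r where "r = (\<lambda>n. measure_pmf.prob (random_lift G A n)
    {H. edge_expansion H \<ge> 1 / (200 * real (card (pverts G)))} - (1 - 1 / real n ^ (l - 1)))"
  obtain C where C: "\<forall>n\<ge>2. \<bar>r n\<bar> \<le> C / real n ^ l"
    using prob_edge_expansion_bounds[OF assms A] unfolding r_def by blast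
  have "r \<in> O(\<lambda>n. 1 / real n ^ l)"
    by (rule bigoI[of _ C]) (use C in \<open>auto simp: eventually_sequentially intro!: exI[of _ 2]\<close>)
  then show "\<exists>r :: nat \<Rightarrow> real. r \<in> O(\<lambda>n. 1 / real n ^ l) \<and>
      (\<forall>n\<ge>3. measure_pmf.prob (random_lift G A n)
        {H. edge_expansion H \<ge> 1 / (200 * real (card (pverts G)))} = 1 - 1 / real n ^ (l - 1) + r n)"
    by (intro exI[of _ r]) (simp add: r_def)
qed

end
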